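(* Let $\mathbb{F}_q$ be a finite field, let $k_1,k_2\ge 1$ be integers with $\gcd(k_1,k_2)=1$ and $2\nmid k_1$, and let $Q_1=q^{k_1}$, $Q_2=q^{k_2}$. Let $\gamma_1$ and $\gamma_2$ be primitive elements of $\mathbb{F}_{Q_1}$ and $\mathbb{F}_{Q_2}$, respectively. Take $e_1=q-1$, $e_2=1$ and $\alpha_i=\gamma_i^{e_i}$ for $i=1,2$, where $\alpha_1$ and $\alpha_2$ are not conjugate to each other over $\mathbb{F}_q$, and let $n_i$ be the multiplicative order of $\alpha_i$ for $i=1,2$. Let $n=n_1n_2/\gcd(n_1,n_2)$, and let $C=\{c(\beta_1,\beta_2):\beta_1\in\mathbb{F}_{Q_1},\beta_2\in\mathbb{F}_{Q_2}\}\subset\mathbb{F}_q^n$ and $C'=\{c(0,\beta_2):\beta_2\in\mathbb{F}_{Q_2}\}\subset C$, where $c(\beta_1,\beta_2)=\big(T_q^{Q_1}(\beta_1\alpha_1^i)+T_q^{Q_2}(\beta_2\alpha_2^i)\big)_{0\le i\le n-1}$. Then the length of $C$ and $C'$ is $n=n_1n_2=(Q_1-1)(Q_2-1)/(q-1)$, and for every $1\leq j\leq k_1$, the $j$th relative generalized Hamming weight of $C$ with respect to $C'$ is $$M_j(C,C')=n-N_j,$$ where, if $k_1\leq k_2$, then $$N_j=\sum_{\kappa=k_2-j}^{k_1+k_2-j-1}q^\kappa-\sum_{\iota=0}^{k_1-j-1}q^\iota;$$ and if $k_2<k_1$, then $$N_j=\begin{cases}\displaystyle\sum_{\kappa=k_1-j}^{k_1+k_2-j-1}q^\kappa-\sum_{\iota=0}^{k_2-j-1}q^\iota,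 & \text{if } 1\leq j\leq k_2;\\[2mm] \displaystyle q^{k_1-j}\sum_{\iota=0}^{k_2-1}q^\iota, & \text{if } k_2<j\leq k_1.\end{cases}$$
   Context: $T_q^{Q_i}$ denotes the trace map from $\mathbb{F}_{Q_i}$ to $\mathbb{F}_q$. Empty sums are $0$. $\mathbb{F}_{Q_1}$ and $\mathbb{F}_{Q_2}$ are regarded as subfields of a common finite extension of $\mathbb{F}_q$. The code $C$ has dimension $k_1+k_2$ over $\mathbb{F}_q$ and $C'$ has dimension $k_2$. For an $\mathbb{F}_q$-linear subspace $D\subset\mathbb{F}_q^n$, $\mathrm{Supp}(D)$ is the set of coordinate positions $i$ such that $v_i\neq 0$ for some $v\in D$. For linear codes $C'\subset C\subset \mathbb{F}_q^n$ and $1\le j\le \dim C-\dim C'$, the $j$th relative generalized Hamming weight of $C$ with respect to $C'$ is $$M_j(C,C')=\min\{|\mathrm{Supp}(D)| : D\subset C \text{ an } \mathbb{F}_q\text{-linear subspace},\ \dim D=j,\ D\cap C'=\{0\}\}.$$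
   Formalization: The formal statement adds gcd(k_1, q-1) = 1; without it n = n_1 n_2 fails (e.g. q=4, k_1=3, k_2=1 gives n=21, not 63), since gcd(n_1,n_2) = gcd(k_1,q-1). *)

theory Defs
  imports Complex_Main "HOL-Library.Cardinality" "HOL-Library.Function_Algebras"
begin

(* The base field F_q is the finite field type 'q.  A common finite extension containing F_{Q_1}
   and F_{Q_2} is a finite field type 'l together with an embedding of 'q; the F_{Q_i} are
   subfields of 'l, given as subsets. *)

definition field_embedding :: "('q::field \<Rightarrow> 'l::field) \<Rightarrow> bool" where
  "field_embedding emb \<longleftrightarrow>
     emb 1 = 1 \<and> (\<forall>a b. emb (a + b) = emb a + emb b) \<and> (\<forall>a b. emb (a * b) = emb a * emb b)"

definition is_subfield :: "'l::field set \<Rightarrow> bool" where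
  "is_subfield E \<longleftrightarrow>
     0 \<in> E \<and> 1 \<in> E \<and> (\<forall>x\<in>E. \<forall>y\<in>E. x + y \<in> E \<and> x * y \<in> E) \<and> (\<forall>x\<in>E. - x \<in> E \<and> inverse x \<in> E)"

definition primitive_element :: "'l::field set \<Rightarrow> 'l \<Rightarrow> bool" where
  "primitive_element E g \<longleftrightarrow> g \<in> E \<and> E - {0} = range (\<lambda>i::nat. g ^ i)"

definition mult_order :: "'l::field \<Rightarrow> nat" where
  "mult_order x = (LEAST m. 0 < m \<and> x ^ m = 1)"

definition conjugate_over :: "nat \<Rightarrow> 'l::field \<Rightarrow> 'l \<Rightarrow> bool" where
  "conjugate_over q x y \<longleftrightarrow> (\<exists>i::nat. y = x ^ (q ^ i))"

(* The trace from the extension of degree k of F_q down to F_q, q = CARD('q): on that extension the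
   sum x + x^q + ... + x^(q^(k-1)) of the conjugates of x lies in the image of F_q, and it is pulled
   back along the embedding. *)

definition field_trace :: "('q::{field,finite} \<Rightarrow> 'l::field) \<Rightarrow> nat \<Rightarrow> 'l \<Rightarrow> 'q" where
  "field_trace emb k x = inv emb (\<Sum>i<k. x ^ (CARD('q) ^ i))"

(* A vector (v_0,...,v_{n-1}) over F_q is a function on nat that vanishes from n on. *)

definition coord_space :: "nat \<Rightarrow> (nat \<Rightarrow> 'q::field) set" where
  "coord_space n = {v. \<forall>i\<ge>n. v i = 0}"

definition scale_fun :: "'q::field \<Rightarrow> (nat \<Rightarrow> 'q) \<Rightarrow> (nat \<Rightarrow> 'q)" where
  "scale_fun a v = (\<lambda>i. a * v i)"

global_interpretation seq: vector_space "scale_fun :: 'q::field \<Rightarrow> (nat \<Rightarrow> 'q) \<Rightarrow> (nat \<Rightarrow> 'q)"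
  by unfold_locales (auto simp: scale_fun_def plus_fun_def algebra_simps)

definition Supp :: "nat \<Rightarrow> (nat \<Rightarrow> 'q::field) set \<Rightarrow> nat set" where
  "Supp n D = {i. i < n \<and> (\<exists>v\<in>D. v i \<noteq> 0)}"

definition rel_gen_hamming_weight ::
  "nat \<Rightarrow> (nat \<Rightarrow> 'q::field) set \<Rightarrow> (nat \<Rightarrow> 'q) set \<Rightarrow> nat \<Rightarrow> nat" where
  "rel_gen_hamming_weight n C C' j =
     Min {card (Supp n D) | D. seq.subspace D \<and> D \<subseteq> C \<and> seq.dim D = j \<and> D \<inter> C' = {0}}"

definition codeword ::
  "('q::{field,finite} \<Rightarrow> 'l::field) \<Rightarrow> nat \<Rightarrow> nat \<Rightarrow> nat \<Rightarrow> 'l \<Rightarrow> 'l \<Rightarrow> 'l \<Rightarrow> 'l \<Rightarrow> (nat \<Rightarrow> 'q)" where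
  "codeword emb k1 k2 n \<alpha>1 \<alpha>2 \<beta>1 \<beta>2 =
     (\<lambda>i. if i < n
          then field_trace emb k1 (\<beta>1 * \<alpha>1 ^ i) + field_trace emb k2 (\<beta>2 * \<alpha>2 ^ i)
          else 0)"

end

theory Submission
  imports Defs "HOL-Computational_Algebra.Polynomial" "HOL-Number_Theory.Cong" "HOL-Library.Product_Plus"
begin

text \<open>Since \<open>n1\<close> is coprime to both \<open>q - 1\<close> and \<open>n2\<close>, each pair of nonzero elements of \<open>F1\<close> and \<open>F2\<close> is a
  unique nonzero scalar multiple of exactly one of the points \<open>(\<alpha>1 ^ i, \<alpha>2 ^ i)\<close>, \<open>i < n\<close>. A subcode \<open>D\<close> of
  dimension \<open>j\<close> that meets \<open>C'\<close> trivially corresponds to a subspace \<open>W\<close> of \<open>F1 \<times> F2\<close> on which the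
  first projection is injective, and \<open>q - 1\<close> times the number of positions outside \<open>Supp D\<close> is the
  number of pairs with two nonzero entries in the annihilator of \<open>W\<close> under the trace form. That
  number is \<open>q ^ (k1 + k2 - j) - q ^ (k1 - j) - q ^ (k2 - r) + 1\<close>, where \<open>r\<close> is the dimension of the
  second projection of \<open>W\<close>; it is largest for \<open>r = min j k2\<close>.\<close>

section \<open>Counting in vector spaces over a finite field\<close>

lemma CARD_field_ge_2: "2 \<le> CARD('q::{field,finite})"
proof -
  have "card {0, 1::'q} \<le> CARD('q)" by (rule card_mono) auto
  then show ?thesis by simp
qed

locale finite_field_space = vector_space scale
  for scale :: "'q::{field,finite} \<Rightarrow> 'v::ab_group_add \<Rightarrow> 'v" (infixr \<open>*s\<close> 75)
begin

text \<open>Each element of the span is \<open>a *s v + w\<close> for exactly one pair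
  \<open>(a, w)\<close>: two pairs with different scalars would put \<open>v\<close> into
  \<open>W\<close> after division by \<open>a - b\<close>.\<close>

lemma card_span_insert:
  assumes W: "subspace W" and fin: "finite W" and v: "v \<notin> W"
  shows "card (span (insert v W)) = CARD('q) * card W" and "finite (span (insert v W))"
proof -
  have span_W: "span W = W" using W by simp
  have eq: "span (insert v W) = (\<lambda>(a, w). a *s v + w) ` (UNIV \<times> W)"
  proof (intro subset_antisym subsetI)
    fix x assume "x \<in> span (insert v W)"
    then obtain k where "x - k *s v \<in> W"
      using span_W by (auto simp: span_insert)
    then show "x \<in> (\<lambda>(a, w). a *s v + w) ` (UNIV \<times> W)"
      by (intro image_eqI[of _ _ "(k, x - k *s v)"]) auto
  next
    fix x assume "x \<in> (\<lambda>(a, w). a *s v + w) ` (UNIV \<times> W)"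
    then obtain a w where "x = a *s v + w" "w \<in> W" by auto
    then show "x \<in> span (insert v W)"
      using span_base[of w "insert v W"] span_base[of v "insert v W"] by (simp add: span_add span_scale)
  qed
  have inj: "inj_on (\<lambda>(a, w). a *s v + w) (UNIV \<times> W)"
  proof (rule inj_onI, clarsimp)
    fix a b w w'
    assume w: "w \<in> W" "w' \<in> W" and e: "a *s v + w = b *s v + w'"
    have d: "(a - b) *s v = w' - w"
      using e by (simp add: scale_left_diff_distrib algebra_simps)
    have "a = b"
    proof (rule ccontr)
      assume "a \<noteq> b"
      then have "v = inverse (a - b) *s ((a - b) *s v)" by simp
      also have "\<dots> \<in> W"
        unfolding d using W w by (simp add: subspace_diff subspace_scale)
      finally show False using v by simp
    qed
    with e show "a = b \<and> w = w'" by simp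
  qed
  show "card (span (insert v W)) = CARD('q) * card W"
    unfolding eq using card_image[OF inj] by (simp add: card_cartesian_product)
  show "finite (span (insert v W))"
    unfolding eq using fin by simp
qed

text \<open>Each basis vector multiplies the size by q. As q is at least 2, dimensions can be traded
  for cardinalities, and later counts are phrased that way.\<close>

lemma card_subspace:
  assumes W: "subspace W" and fin: "finite W"
  shows "card W = CARD('q) ^ dim W"
proof -
  obtain B where B: "B \<subseteq> W" "independent B" "W \<subseteq> span B" "card B = dim W"
    by (rule basis_exists)
  have "finite B" using B(1) fin finite_subset by blast
  have "card (span B) = CARD('q) ^ card B \<and> finite (span B)"
    using \<open>finite B\<close> B(2)
  proof (induction B rule: finite_induct)
    case (insert x B)
    then have ind: "independent B" and x: "x \<notin> span B"
      by (simp_all add: independent_insert)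
    have eq: "span (insert x B) = span (insert x (span B))"
      by (simp add: span_insert span_span)
    show ?case
      unfolding eq using card_span_insert[OF subspace_span _ x] insert.IH[OF ind] insert.hyps
      by simp
  qed simp
  moreover have "span B = W"
    using B(1,3) W by (rule span_subspace)
  ultimately show ?thesis using B(4) by simp
qed

text \<open>\<open>W\<close> is the span of the kernel and one vector \<open>v\<close> outside it,
  so \<open>card_span_insert\<close> applies. Linearity is asked on \<open>W\<close> only, because
  the trace is known to be linear only on its own subfield.\<close>

lemma card_kernel:
  fixes f :: "'v \<Rightarrow> 'q"
  assumes W: "subspace W" and fin: "finite W"
    and add: "\<And>x y. x \<in> W \<Longrightarrow> y \<in> W \<Longrightarrow> f (x + y) = f x + f y"
    and scl: "\<And>a x. x \<in> W \<Longrightarrow> f (a *s x) = a * f x"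
    and v: "v \<in> W" "f v \<noteq> 0"
  shows "CARD('q) * card {w \<in> W. f w = 0} = card W"
proof -
  let ?K = "{w \<in> W. f w = 0}"
  have K: "subspace ?K"
  proof (rule subspaceI)
    show "0 \<in> ?K" using scl[OF v(1), of 0] W by (simp add: subspace_0)
  qed (use W add scl in \<open>auto simp: subspace_add subspace_scale\<close>)
  have "W \<subseteq> span (insert v ?K)"
  proof
    fix x assume x: "x \<in> W"
    let ?k = "f x / f v"
    have "f (x + (- ?k) *s v) = f x + (- ?k) * f v"
      using x v W by (simp only: add scl subspace_scale)
    then have "x - ?k *s v \<in> ?K"
      using x v W by (simp add: subspace_diff subspace_scale)
    then have "x - ?k *s v \<in> span ?K" by (rule span_base)
    then show "x \<in> span (insert v ?K)"
      unfolding span_breakdown_eq by (rule exI)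
  qed
  moreover have "span (insert v ?K) \<subseteq> W"
    using W v by (intro span_minimal) auto
  ultimately have "span (insert v ?K) = W" by simp
  then show ?thesis
    using card_span_insert(1)[OF K, of v] fin v by simp
qed

text \<open>Double counting of the pairs \<open>(w, y)\<close> with \<open>B w y = 0\<close>: a functional is zero or vanishes on
  exactly one \<open>q\<close>-th of its domain.\<close>

lemma card_annihilator:
  fixes B :: "'v \<Rightarrow> 'v \<Rightarrow> 'q"
  assumes W: "subspace W" "finite W" and V: "subspace V" "finite V"
    and add1: "\<And>x x' y. x \<in> W \<Longrightarrow> x' \<in> W \<Longrightarrow> y \<in> V \<Longrightarrow> B (x + x') y = B x y + B x' y"
    and scl1: "\<And>a x y. x \<in> W \<Longrightarrow> y \<in> V \<Longrightarrow> B (a *s x) y = a * B x y"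
    and add2: "\<And>x y y'. x \<in> W \<Longrightarrow> y \<in> V \<Longrightarrow> y' \<in> V \<Longrightarrow> B x (y + y') = B x y + B x y'"
    and scl2: "\<And>a x y. x \<in> W \<Longrightarrow> y \<in> V \<Longrightarrow> B x (a *s y) = a * B x y"
    and nondeg: "\<And>x. x \<in> W \<Longrightarrow> x \<noteq> 0 \<Longrightarrow> \<exists>y\<in>V. B x y \<noteq> 0"
  shows "card W * card {y \<in> V. \<forall>x\<in>W. B x y = 0} = card V"
proof -
  let ?q = "CARD('q)"
  let ?P = "{y \<in> V. \<forall>x\<in>W. B x y = 0}"
  have zero: "B 0 y = 0" if "y \<in> V" for y
    using scl1[of 0 y 0] that W by (simp add: subspace_0)
  have "0 \<in> W" using W(1) by (rule subspace_0)
  have W_split: "int ?q * (\<Sum>x\<in>W. int (card {y \<in> V. B x y = 0})) =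
      int ?q * int (card V) + (int (card W) - 1) * int (card V)"
  proof -
    have "(\<Sum>x\<in>W. int ?q * int (card {y \<in> V. B x y = 0})) =
        int ?q * int (card {y \<in> V. B 0 y = 0})
        + (\<Sum>x\<in>W - {0}. int ?q * int (card {y \<in> V. B x y = 0}))"
      using W(2) \<open>0 \<in> W\<close> by (rule sum.remove)
    also have "{y \<in> V. B 0 y = 0} = V" using zero by auto
    also have "(\<Sum>x\<in>W - {0}. int ?q * int (card {y \<in> V. B x y = 0})) =
        (\<Sum>x\<in>W - {0}. int (card V))"
    proof (rule sum.cong[OF refl])
      fix x assume x: "x \<in> W - {0}"
      then obtain v where v: "v \<in> V" "B x v \<noteq> 0" using nondeg by blast
      have "?q * card {y \<in> V. B x y = 0} = card V"
        using x by (intro card_kernel[OF V, where f = "B x" and v = v] add2 scl2 v) auto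
      then show "int ?q * int (card {y \<in> V. B x y = 0}) = int (card V)"
        by (metis of_nat_mult)
    qed
    also have "\<dots> = (int (card W) - 1) * int (card V)"
    proof -
      have "card W > 0" using W(2) \<open>0 \<in> W\<close> by (auto simp: card_gt_0_iff)
      then show ?thesis using W(2) \<open>0 \<in> W\<close> by (simp add: of_nat_diff card_Diff_singleton)
    qed
    finally show ?thesis by (simp add: sum_distrib_left)
  qed
  have V_split: "int ?q * (\<Sum>y\<in>V. int (card {x \<in> W. B x y = 0})) =
      int ?q * int (card ?P) * int (card W) + (int (card V) - int (card ?P)) * int (card W)"
  proof -
    have "(\<Sum>y\<in>V. int ?q * int (card {x \<in> W. B x y = 0})) =
       (\<Sum>y\<in>V - ?P. int ?q * int (card {x \<in> W. B x y = 0}))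
       + (\<Sum>y\<in>?P. int ?q * int (card {x \<in> W. B x y = 0}))"
      using V(2) by (intro sum.subset_diff) auto
    also have "(\<Sum>y\<in>?P. int ?q * int (card {x \<in> W. B x y = 0})) =
        (\<Sum>y\<in>?P. int ?q * int (card W))"
    proof (rule sum.cong[OF refl])
      fix y assume "y \<in> ?P"
      then have "{x \<in> W. B x y = 0} = W" by auto
      then show "int ?q * int (card {x \<in> W. B x y = 0}) = int ?q * int (card W)" by simp
    qed
    also have "(\<Sum>y\<in>V - ?P. int ?q * int (card {x \<in> W. B x y = 0})) =
        (\<Sum>y\<in>V - ?P. int (card W))"
    proof (rule sum.cong[OF refl])
      fix y assume y: "y \<in> V - ?P"
      then obtain v where v: "v \<in> W" "B v y \<noteq> 0" by blast
      have "?q * card {x \<in> W. B x y = 0} = card W"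
        using y by (intro card_kernel[OF W, where f = "\<lambda>x. B x y" and v = v] add1 scl1 v) auto
      then show "int ?q * int (card {x \<in> W. B x y = 0}) = int (card W)"
        by (metis of_nat_mult)
    qed
    also have "(\<Sum>y\<in>V - ?P. int (card W)) = (int (card V) - int (card ?P)) * int (card W)"
    proof -
      have "card (V - ?P) = card V - card ?P" "card ?P \<le> card V"
        using V(2) by (auto intro!: card_Diff_subset card_mono)
      then show ?thesis by (simp add: of_nat_diff)
    qed
    finally show ?thesis by (simp add: sum_distrib_left algebra_simps)
  qed
  have "(\<Sum>x\<in>W. card {y \<in> V. B x y = 0}) = (\<Sum>y\<in>V. card {x \<in> W. B x y = 0})"
    using sum.swap_restrict[OF W(2) V(2), of "\<lambda>_ _. 1::nat" "\<lambda>x y. B x y = 0"] by simp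
  then have "(\<Sum>x\<in>W. int (card {y \<in> V. B x y = 0})) = (\<Sum>y\<in>V. int (card {x \<in> W. B x y = 0}))"
    by (simp only: flip: of_nat_sum)
  \<comment> \<open>With P the annihilator, the double count reads q|V| + (|W| - 1)|V| = q|P||W| +
    (|V| - |P|)|W|. The terms |V||W| cancel and leave a factor q - 1 on both sides.\<close>
  with W_split V_split
  have "(int ?q - 1) * (int (card W) * int (card ?P)) = (int ?q - 1) * int (card V)"
    by (simp add: algebra_simps)
  moreover have "int ?q - 1 \<noteq> 0" using CARD_field_ge_2[where 'q = 'q] by linarith
  ultimately have "int (card W * card ?P) = int (card V)" by simp
  then show ?thesis by linarith
qed

end

section \<open>Finite fields and the trace\<close>

text \<open>Multiplication by \<open>x\<close> permutes the nonzero elements, so their nonzero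
  product is unchanged by the factor \<open>x ^ (card F - 1)\<close>.\<close>

lemma subfield_power_card_minus_1:
  fixes F :: "'l::field set"
  assumes F: "is_subfield F" "finite F" and x: "x \<in> F" "x \<noteq> 0"
  shows "x ^ (card F - 1) = 1"
proof -
  let ?U = "F - {0}"
  have "0 \<in> F" using F by (simp add: is_subfield_def)
  have "(\<Prod>y\<in>?U. x * y) = (\<Prod>y\<in>?U. y)"
  proof (rule prod.reindex_bij_witness[of _ "\<lambda>y. inverse x * y" "\<lambda>y. x * y"])
    fix y assume "y \<in> ?U"
    then show "x * y \<in> ?U" "inverse x * y \<in> ?U"
      using F x by (auto simp: is_subfield_def)
  qed (use x in auto)
  moreover have "(\<Prod>y\<in>?U. x * y) = x ^ (card F - 1) * (\<Prod>y\<in>?U. y)"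
    using F(2) \<open>0 \<in> F\<close> by (simp add: prod.distrib card_Diff_singleton)
  moreover have "(\<Prod>y\<in>?U. y) \<noteq> 0" using F(2) by simp
  ultimately show ?thesis by simp
qed

lemma subfield_power_card:
  fixes F :: "'l::field set"
  assumes F: "is_subfield F" "finite F" and x: "x \<in> F"
  shows "x ^ card F = x"
proof -
  have "card F > 0" using F by (auto simp: card_gt_0_iff is_subfield_def)
  then show ?thesis
    using subfield_power_card_minus_1[OF F x]
    by (cases "x = 0") (auto simp: power_eq_if power_0_left)
qed

lemma is_subfield_UNIV: "is_subfield UNIV"
  by (simp add: is_subfield_def)

lemma power_CARD_eq: "(a::'q::{field,finite}) ^ CARD('q) = a"
  using subfield_power_card[OF is_subfield_UNIV, of a] by simp

text \<open>The polynomials \<open>(X + 1)\<^sup>q\<close> and \<open>X\<^sup>q + 1\<close> have the same leading coefficient and agree at all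
  \<open>q\<close> elements of the field, so they are equal.\<close>

lemma of_nat_choose_CARD_eq_0:
  assumes "0 < i" "i < CARD('q::{field,finite})"
  shows "of_nat (CARD('q) choose i) = (0::'q)"
proof -
  let ?q = "CARD('q)"
  let ?p = "[:1, 1::'q:] ^ ?q" and ?r = "monom (1::'q) ?q + 1"
  have cp: "coeff ?p k = of_nat (?q choose k)" if "k \<le> ?q" for k
    using coeff_linear_poly_power[of k ?q "1::'q" 1] that by simp
  have "?p = ?r"
  proof (rule poly_eqI_degree_lead_coeff[of _ ?q _ UNIV])
    show "coeff ?p ?q = coeff ?r ?q"
      using cp[of ?q] by simp
    show "degree ?p \<le> ?q"
      using degree_power_le[of "[:1, 1::'q:]" ?q] by simp
    show "degree ?r \<le> ?q"
      by (intro degree_add_le degree_monom_le) simp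
  qed (simp_all add: poly_monom power_CARD_eq)
  then have "coeff ?p i = coeff ?r i" by simp
  then show ?thesis using cp[of i] assms by simp
qed

section \<open>Frobenius map and trace over an embedded base field\<close>

context
  fixes emb :: "'q::{field,finite} \<Rightarrow> 'l::{field,finite}"
  assumes emb: "field_embedding emb"
begin

lemma emb_simps:
  shows "emb 1 = 1" "emb 0 = 0" "emb (a + b) = emb a + emb b" "emb (a * b) = emb a * emb b"
proof -
  show "emb 1 = 1" "emb (a + b) = emb a + emb b" "emb (a * b) = emb a * emb b"
    using emb by (simp_all add: field_embedding_def)
  have "emb (0 + 0) = emb 0 + emb 0" using emb unfolding field_embedding_def by blast
  then show "emb 0 = 0" by (metis add.right_neutral add_left_cancel)
qed

lemma emb_power: "emb (a ^ m) = emb a ^ m"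
  by (induction m) (simp_all add: emb_simps)

lemma emb_of_nat: "emb (of_nat m) = of_nat m"
  by (induction m) (simp_all add: emb_simps)

lemma emb_eq_0_iff: "emb a = 0 \<longleftrightarrow> a = 0"
  by (metis emb_simps(1,2,4) mult_zero_left right_inverse zero_neq_one)

lemma inj_emb: "inj emb"
proof (rule injI)
  fix a b assume e: "emb a = emb b"
  have "emb (a - b) + emb b = emb a" by (metis emb_simps(3) diff_add_cancel)
  then have "emb (a - b) = 0" using e by simp
  then show "a = b" by (simp add: emb_eq_0_iff)
qed

text \<open>The inner binomial coefficients vanish in the base field, and \<open>emb\<close> carries
  this to the extension, so the characteristic never has to be named.\<close>

lemma frobenius_add:
  fixes x y :: 'l
  shows "(x + y) ^ CARD('q) = x ^ CARD('q) + y ^ CARD('q)"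
proof -
  let ?q = "CARD('q)"
  have "(x + y) ^ ?q = (\<Sum>k\<le>?q. of_nat (?q choose k) * x ^ k * y ^ (?q - k))"
    by (rule binomial_ring)
  also have "\<dots> = (\<Sum>k\<in>{0, ?q}. of_nat (?q choose k) * x ^ k * y ^ (?q - k))"
  proof (rule sum.mono_neutral_right)
    show "\<forall>k\<in>{..?q} - {0, ?q}. of_nat (?q choose k) * x ^ k * y ^ (?q - k) = 0"
    proof
      fix k assume "k \<in> {..?q} - {0, ?q}"
      then have "of_nat (?q choose k) = (0::'q)"
        by (intro of_nat_choose_CARD_eq_0) auto
      then have "of_nat (?q choose k) = (0::'l)"
        by (metis emb_of_nat emb_simps(2))
      then show "of_nat (?q choose k) * x ^ k * y ^ (?q - k) = 0" by simp
    qed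
  qed auto
  finally show ?thesis by (simp add: add.commute)
qed

lemma frobenius_iterate_add:
  fixes x y :: 'l
  shows "(x + y) ^ (CARD('q) ^ i) = x ^ (CARD('q) ^ i) + y ^ (CARD('q) ^ i)"
  by (induction i) (simp_all add: power_mult mult.commute[of "CARD('q)"] frobenius_add)

lemma frobenius_sum:
  fixes f :: "'a \<Rightarrow> 'l"
  assumes "finite A"
  shows "(\<Sum>i\<in>A. f i) ^ CARD('q) = (\<Sum>i\<in>A. f i ^ CARD('q))"
  using assms by (induction A rule: finite_induct) (simp_all add: frobenius_add power_0_left)

lemma emb_power_CARD_power: "emb a ^ (CARD('q) ^ i) = emb a"
  by (induction i) (simp_all add: power_mult mult.commute[of "CARD('q)"] power_CARD_eq
    flip: emb_power)

text \<open>The polynomial X^q - X has at most q roots, and the image of \<open>emb\<close> already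
  supplies q of them.\<close>

lemma fixed_by_frobenius:
  fixes z :: 'l
  assumes "z ^ CARD('q) = z"
  shows "z \<in> range emb"
proof -
  let ?q = "CARD('q)"
  let ?p = "monom (1::'l) ?q - monom 1 1"
  let ?R = "{x. poly ?p x = 0}"
  have q2: "2 \<le> ?q" by (rule CARD_field_ge_2)
  have "coeff ?p ?q = 1" using q2 by simp
  then have p0: "?p \<noteq> 0" by (metis coeff_0 zero_neq_one)
  have "degree ?p \<le> ?q"
    using q2 by (intro degree_diff_le) (auto intro: order_trans[OF degree_monom_le])
  then have "card ?R \<le> ?q"
    using card_poly_roots_bound[OF p0] by simp
  moreover have "range emb \<subseteq> ?R"
    using emb_power_CARD_power[of _ 1] by (auto simp: poly_monom)
  moreover have "card (range emb) = ?q" by (simp add: card_image inj_emb)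
  ultimately have "range emb = ?R"
    using poly_roots_finite[OF p0] by (intro card_seteq) auto
  moreover have "z \<in> ?R" using assms by (simp add: poly_monom)
  ultimately show ?thesis by simp
qed

context
  fixes F :: "'l set" and k :: nat
  assumes F: "is_subfield F" "range emb \<subseteq> F" "card F = CARD('q) ^ k"
begin

lemma subfield_degree_pos: "0 < k"
proof (rule ccontr)
  assume "\<not> 0 < k"
  then have "card F = 1" using F by simp
  moreover have "card {0, 1::'l} \<le> card F"
    using F(1) by (intro card_mono) (auto simp: is_subfield_def)
  ultimately show False by simp
qed

text \<open>Raising to the q-th power shifts the conjugates of \<open>x\<close> cyclically, so their
  sum is fixed and lies in the image of \<open>emb\<close>. This makes the \<open>inv emb\<close> in
  \<open>field_trace\<close> a true preimage.\<close>

lemma emb_field_trace: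
  assumes x: "x \<in> F"
  shows "emb (field_trace emb k x) = (\<Sum>i<k. x ^ (CARD('q) ^ i))"
proof -
  let ?q = "CARD('q)"
  let ?S = "\<Sum>i<k. x ^ (?q ^ i)"
  have "?S ^ ?q = (\<Sum>i<k. x ^ (?q ^ Suc i))"
    by (simp add: frobenius_sum mult.commute[of ?q] power_mult)
  also have "\<dots> = (\<Sum>i\<in>{1..<Suc k}. x ^ (?q ^ i))"
    unfolding lessThan_atLeast0
    using sum.shift_bounds_Suc_ivl[of "\<lambda>i. x ^ (?q ^ i)" 0 k] by simp
  also have "\<dots> = (\<Sum>i\<in>{1..<k}. x ^ (?q ^ i)) + x ^ (?q ^ k)"
    using subfield_degree_pos by simp
  \<comment> \<open>The last conjugate wraps around to the first because \<open>card F\<close> is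
    q^k.\<close>
  also have "x ^ (?q ^ k) = x ^ (?q ^ 0)"
    using subfield_power_card[OF F(1) _ x] F(3) by simp
  also have "(\<Sum>i\<in>{1..<k}. x ^ (?q ^ i)) + x ^ (?q ^ 0) = ?S"
    unfolding lessThan_atLeast0 using subfield_degree_pos by (simp add: sum.atLeast_Suc_lessThan)
  finally have "?S \<in> range emb" by (rule fixed_by_frobenius)
  then show ?thesis
    unfolding field_trace_def by (rule f_inv_into_f)
qed

text \<open>Trace identities are compared after applying the injective \<open>emb\<close>, where the
  trace is a sum of Frobenius powers.\<close>

lemma field_trace_add:
  assumes "x \<in> F" "y \<in> F"
  shows "field_trace emb k (x + y) = field_trace emb k x + field_trace emb k y"
proof -
  have "x + y \<in> F" using F(1) assms by (simp add: is_subfield_def)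
  then have "emb (field_trace emb k (x + y)) = emb (field_trace emb k x + field_trace emb k y)"
    using assms by (simp add: emb_field_trace emb_simps frobenius_iterate_add sum.distrib)
  then show ?thesis using inj_emb by (simp add: inj_eq)
qed

lemma field_trace_scale:
  assumes "x \<in> F"
  shows "field_trace emb k (emb a * x) = a * field_trace emb k x"
proof -
  have "emb a * x \<in> F" using F(1,2) assms by (auto simp: is_subfield_def)
  then have "emb (field_trace emb k (emb a * x)) = emb (a * field_trace emb k x)"
    using assms
    by (simp add: emb_field_trace emb_simps power_mult_distrib emb_power_CARD_power sum_distrib_left)
  then show ?thesis using inj_emb by (simp add: inj_eq)
qed

lemma field_trace_0: "field_trace emb k 0 = 0"
  using field_trace_scale[of 0 0] F(1) by (simp add: is_subfield_def)

text \<open>As a polynomial the trace is nonzero of degree at most q^(k-1), too small to vanish at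
  all q^k elements of \<open>F\<close>.\<close>

lemma field_trace_nonzero: "\<exists>z\<in>F. field_trace emb k z \<noteq> 0"
proof (rule ccontr)
  assume asm: "\<not> ?thesis"
  let ?q = "CARD('q)"
  let ?p = "\<Sum>i<k. monom (1::'l) (?q ^ i)"
  have q2: "2 \<le> ?q" by (rule CARD_field_ge_2)
  \<comment> \<open>The exponents \<open>?q ^ i\<close> are distinct as q is at least 2, so only
    \<open>i = k - 1\<close> contributes to this coefficient.\<close>
  have "coeff ?p (?q ^ (k - 1)) = (\<Sum>i<k. if i = k - 1 then 1 else 0)"
    unfolding coeff_sum using q2 by (intro sum.cong) auto
  also have "\<dots> = 1" using subfield_degree_pos by simp
  finally have p0: "?p \<noteq> 0" by (metis coeff_0 zero_neq_one)
  have "degree ?p \<le> ?q ^ (k - 1)"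
  proof (rule degree_sum_le)
    fix i assume "i \<in> {..<k}"
    then have "?q ^ i \<le> ?q ^ (k - 1)" using q2 by (intro power_increasing) auto
    then show "degree (monom (1::'l) (?q ^ i)) \<le> ?q ^ (k - 1)"
      using degree_monom_le order_trans by blast
  qed simp
  then have "card {x. poly ?p x = 0} \<le> ?q ^ (k - 1)"
    using card_poly_roots_bound[OF p0] by simp
  moreover have "F \<subseteq> {x. poly ?p x = 0}"
  proof
    fix x assume x: "x \<in> F"
    then have "emb (field_trace emb k x) = 0" using asm emb_simps(2) by auto
    then show "x \<in> {x. poly ?p x = 0}"
      using x by (simp add: emb_field_trace poly_sum poly_monom)
  qed
  then have "card F \<le> card {x. poly ?p x = 0}"
    by (intro card_mono) auto
  moreover have "?q ^ (k - 1) < ?q ^ k"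
    using q2 subfield_degree_pos by (intro power_strict_increasing) auto
  ultimately show False using F(3) by simp
qed

lemma field_trace_nondegenerate:
  assumes "b \<in> F" "b \<noteq> 0"
  shows "\<exists>x\<in>F. field_trace emb k (b * x) \<noteq> 0"
proof -
  obtain z where z: "z \<in> F" "field_trace emb k z \<noteq> 0" using field_trace_nonzero by blast
  have "inverse b * z \<in> F" using F(1) assms z by (simp add: is_subfield_def)
  moreover have "b * (inverse b * z) = z" using assms by simp
  ultimately show ?thesis using z(2) by metis
qed

end

end

text \<open>If \<open>b\<close> is nonzero, some \<open>b * y\<close> has nonzero trace. A third
  element allows \<open>z\<close> and \<open>z + y\<close> to be both nonzero, and additivity then
  makes that trace zero. Two elements would not do: over F_2 the trace of F_2 is 1 at the only
  nonzero element.\<close>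

lemma constant_trace_imp_zero:
  fixes emb :: "'q::{field,finite} \<Rightarrow> 'l::{field,finite}"
  assumes emb: "field_embedding emb"
    and F: "is_subfield F" "range emb \<subseteq> F" "card F = CARD('q) ^ k"
    and card: "3 \<le> card F" and b: "b \<in> F"
    and const: "\<And>y. y \<in> F \<Longrightarrow> y \<noteq> 0 \<Longrightarrow> field_trace emb k (b * y) = t"
  shows "b = 0"
proof (rule ccontr)
  assume "b \<noteq> 0"
  then obtain y where y: "y \<in> F" "field_trace emb k (b * y) \<noteq> 0"
    using field_trace_nondegenerate[OF emb F b] by blast
  have F_add: "u + v \<in> F" and F_mult: "u * v \<in> F" if "u \<in> F" "v \<in> F" for u v
    using F(1) that by (simp_all add: is_subfield_def)
  have "y \<noteq> 0" using y field_trace_0[OF emb F] by auto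
  have "\<not> F \<subseteq> {0, - y}"
  proof
    assume "F \<subseteq> {0, - y}"
    then have "card F \<le> card {0, - y}" by (intro card_mono) auto
    also have "\<dots> \<le> 2" by (simp add: card_insert_if)
    finally show False using card by simp
  qed
  then obtain z where z: "z \<in> F" "z \<noteq> 0" "z \<noteq> - y" by blast
  then have "z + y \<noteq> 0" by (simp add: add_eq_0_iff2)
  then have "t = field_trace emb k (b * (z + y))"
    using const z y F_add by simp
  also have "\<dots> = field_trace emb k (b * z) + field_trace emb k (b * y)"
    using z y b by (simp add: distrib_left field_trace_add[OF emb F] F_mult)
  also have "\<dots> = t + field_trace emb k (b * y)"
    using const z by simp
  finally show False using y by simp
qed

section \<open>Pairs of field elements with the trace form\<close>

locale trace_pair =
  fixes emb :: "'q::{field,finite} \<Rightarrow> 'l::{field,finite}"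
    and F1 F2 :: "'l set" and k1 k2 :: nat
  assumes emb: "field_embedding emb"
    and F1: "is_subfield F1" "range emb \<subseteq> F1" "card F1 = CARD('q) ^ k1"
    and F2: "is_subfield F2" "range emb \<subseteq> F2" "card F2 = CARD('q) ^ k2"
begin

abbreviation lscale :: "'q \<Rightarrow> 'l \<Rightarrow> 'l" where
  "lscale a x \<equiv> emb a * x"

abbreviation pscale :: "'q \<Rightarrow> 'l \<times> 'l \<Rightarrow> 'l \<times> 'l" where
  "pscale a p \<equiv> (emb a * fst p, emb a * snd p)"

abbreviation "T1 \<equiv> field_trace emb k1"
abbreviation "T2 \<equiv> field_trace emb k2"

text \<open>The trace form on pairs. Its value at \<open>p\<close> and
  \<open>(\<alpha>1 ^ i, \<alpha>2 ^ i)\<close> is coordinate \<open>i\<close> of the codeword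
  belonging to \<open>p\<close>.\<close>

definition form :: "'l \<times> 'l \<Rightarrow> 'l \<times> 'l \<Rightarrow> 'q" where
  "form p r = T1 (fst p * fst r) + T2 (snd p * snd r)"

definition perp :: "('l \<times> 'l) set \<Rightarrow> ('l \<times> 'l) set" where
  "perp W = {r \<in> F1 \<times> F2. \<forall>p\<in>W. form p r = 0}"

text \<open>\<open>perp1\<close> and \<open>perp2\<close> are the parts of \<open>perp\<close> on
  the two coordinate axes, each written as a set of single field elements.\<close>

definition perp1 :: "('l \<times> 'l) set \<Rightarrow> 'l set" where
  "perp1 W = {x \<in> F1. \<forall>p\<in>W. T1 (fst p * x) = 0}"

definition perp2 :: "('l \<times> 'l) set \<Rightarrow> 'l set" where
  "perp2 W = {y \<in> F2. \<forall>p\<in>W. T2 (snd p * y) = 0}"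

lemmas emb_simps' = emb_simps[OF emb]

sublocale l: finite_field_space lscale
  by unfold_locales (simp_all add: emb_simps' algebra_simps)

sublocale p: finite_field_space pscale
  by unfold_locales (simp_all add: emb_simps' algebra_simps prod_eq_iff)

sublocale fst: Vector_Spaces.linear pscale lscale fst
  unfolding Vector_Spaces.linear_iff
  by (simp add: l.vector_space_axioms p.vector_space_axioms)

sublocale snd: Vector_Spaces.linear pscale lscale snd
  unfolding Vector_Spaces.linear_iff
  by (simp add: l.vector_space_axioms p.vector_space_axioms)

lemma F_closed [intro, simp]:
  "0 \<in> F1" "0 \<in> F2" "1 \<in> F1" "1 \<in> F2" "emb a \<in> F1" "emb a \<in> F2"
  "x \<in> F1 \<Longrightarrow> y \<in> F1 \<Longrightarrow> x + y \<in> F1" "x \<in> F2 \<Longrightarrow> y \<in> F2 \<Longrightarrow> x + y \<in> F2"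
  "x \<in> F1 \<Longrightarrow> y \<in> F1 \<Longrightarrow> x * y \<in> F1" "x \<in> F2 \<Longrightarrow> y \<in> F2 \<Longrightarrow> x * y \<in> F2"
  using F1(1,2) F2(1,2) by (auto simp: is_subfield_def)

lemma F_power [intro, simp]: "x \<in> F1 \<Longrightarrow> x ^ i \<in> F1" "x \<in> F2 \<Longrightarrow> x ^ i \<in> F2"
  by (induction i) auto

lemma subspace_F: "l.subspace F1" "l.subspace F2" "p.subspace (F1 \<times> F2)"
  by (auto intro!: l.subspaceI p.subspaceI simp: zero_prod_def)

lemmas T1_simps = field_trace_add[OF emb F1] field_trace_scale[OF emb F1] field_trace_0[OF emb F1]
lemmas T2_simps = field_trace_add[OF emb F2] field_trace_scale[OF emb F2] field_trace_0[OF emb F2]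

lemma form_add_left:
  assumes "p \<in> F1 \<times> F2" "p' \<in> F1 \<times> F2" "r \<in> F1 \<times> F2"
  shows "form (p + p') r = form p r + form p' r"
  using assms by (auto simp: form_def distrib_right T1_simps T2_simps algebra_simps)

lemma form_scale_left:
  assumes "p \<in> F1 \<times> F2" "r \<in> F1 \<times> F2"
  shows "form (pscale a p) r = a * form p r"
  using assms by (auto simp: form_def distrib_left T1_simps T2_simps mult.assoc)

lemma form_commute: "form p r = form r p"
  by (simp add: form_def mult.commute)

text \<open>Testing against a pair with one entry zero leaves only the trace of a nonzero
  component.\<close>

lemma form_nondegenerate:
  assumes "p \<in> F1 \<times> F2" "p \<noteq> 0"
  shows "\<exists>r\<in>F1 \<times> F2. form p r \<noteq> 0"
proof (cases "fst p = 0")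
  case True
  then have "snd p \<in> F2" "snd p \<noteq> 0" using assms by (auto simp: prod_eq_iff)
  then obtain y where "y \<in> F2" "T2 (snd p * y) \<noteq> 0"
    using field_trace_nondegenerate[OF emb F2] by blast
  then show ?thesis
    using T1_simps(3) by (intro bexI[of _ "(0, y)"]) (auto simp: form_def)
next
  case False
  then have "fst p \<in> F1" using assms by auto
  then obtain x where "x \<in> F1" "T1 (fst p * x) \<noteq> 0"
    using False field_trace_nondegenerate[OF emb F1] by blast
  then show ?thesis
    using T2_simps(3) by (intro bexI[of _ "(x, 0)"]) (auto simp: form_def)
qed

text \<open>Codewords test the form only at pairs with two nonzero entries, so plain nondegeneracy
  is not enough. Fixing one entry at 1 makes the other trace constant, which kills \<open>b\<close>
  or \<open>c\<close>; nondegeneracy kills the remaining one. If both fields are F_2, then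
  \<open>(1, 1)\<close> is a counterexample.\<close>

lemma form_kernel_trivial:
  assumes card: "3 \<le> card F1 \<or> 3 \<le> card F2"
    and p: "p \<in> F1 \<times> F2"
    and vanish: "\<And>x y. x \<in> F1 \<Longrightarrow> x \<noteq> 0 \<Longrightarrow> y \<in> F2 \<Longrightarrow> y \<noteq> 0 \<Longrightarrow> form p (x, y) = 0"
  shows "p = 0"
proof -
  obtain b c where p_eq: "p = (b, c)" and b: "b \<in> F1" and c: "c \<in> F2"
    using p by auto
  have v: "T1 (b * x) + T2 (c * y) = 0" if "x \<in> F1" "x \<noteq> 0" "y \<in> F2" "y \<noteq> 0" for x y
    using vanish[OF that] by (simp add: form_def p_eq)
  have "b = 0 \<or> c = 0"
    using card
  proof
    assume 3: "3 \<le> card F1"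
    have "T1 (b * x) = - T2 (c * 1)" if "x \<in> F1" "x \<noteq> 0" for x
      using v[OF that, of 1] by (simp add: add_eq_0_iff2)
    then show ?thesis using constant_trace_imp_zero[OF emb F1 3 b] by blast
  next
    assume 3: "3 \<le> card F2"
    have "T2 (c * y) = - T1 (b * 1)" if "y \<in> F2" "y \<noteq> 0" for y
      using v[OF _ _ that, of 1] by (simp add: add_eq_0_iff)
    then show ?thesis using constant_trace_imp_zero[OF emb F2 3 c] by blast
  qed
  moreover have "c = 0" if "b = 0"
  proof (rule ccontr)
    assume "c \<noteq> 0"
    then obtain y where y: "y \<in> F2" "T2 (c * y) \<noteq> 0"
      using field_trace_nondegenerate[OF emb F2 c] by blast
    then have "y \<noteq> 0" using T2_simps(3) by auto
    then show False using v[of 1 y] y that T1_simps(3) by simp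
  qed
  moreover have "b = 0" if "c = 0"
  proof (rule ccontr)
    assume "b \<noteq> 0"
    then obtain x where x: "x \<in> F1" "T1 (b * x) \<noteq> 0"
      using field_trace_nondegenerate[OF emb F1 b] by blast
    then have "x \<noteq> 0" using T1_simps(3) by auto
    then show False using v[of x 1] x that T2_simps(3) by simp
  qed
  ultimately show ?thesis by (auto simp: p_eq zero_prod_def)
qed

section \<open>Sizes of the annihilator of a subspace and of its axis parts\<close>

context
  fixes W :: "('l \<times> 'l) set"
  assumes W: "p.subspace W" "W \<subseteq> F1 \<times> F2"
begin

lemma card_perp: "card W * card (perp W) = CARD('q) ^ (k1 + k2)"
proof -
  have "card W * card (perp W) = card (F1 \<times> F2)"
    unfolding perp_def
  proof (rule p.card_annihilator)
    show "form x (y + y') = form x y + form x y'"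
      if "x \<in> W" "y \<in> F1 \<times> F2" "y' \<in> F1 \<times> F2" for x y y'
      using form_add_left[of y y' x] that W(2) by (auto simp: form_commute[of x])
    show "form x (pscale a y) = a * form x y" if "x \<in> W" "y \<in> F1 \<times> F2" for a x y
      using form_scale_left[of y x a] that W(2) by (auto simp: form_commute[of x])
    show "form (x + x') y = form x y + form x' y"
      if "x \<in> W" "x' \<in> W" "y \<in> F1 \<times> F2" for x x' y
      using that W(2) by (intro form_add_left) auto
    show "form (pscale a x) y = a * form x y" if "x \<in> W" "y \<in> F1 \<times> F2" for a x y
      using that W(2) by (intro form_scale_left) auto
    show "\<exists>y\<in>F1 \<times> F2. form x y \<noteq> 0" if "x \<in> W" "x \<noteq> 0" for x
      using that W(2) by (intro form_nondegenerate) auto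
  qed (use W subspace_F in auto)
  then show ?thesis by (simp add: card_cartesian_product F1 F2 power_add)
qed

text \<open>\<open>perp1 W\<close> depends only on the first projection of \<open>W\<close>: it is
  the annihilator of that projection inside \<open>F1\<close>.\<close>

lemma card_perp1: "card (fst ` W) * card (perp1 W) = CARD('q) ^ k1"
proof -
  have "card (fst ` W) * card {x \<in> F1. \<forall>b\<in>fst ` W. T1 (b * x) = 0} = card F1"
  proof (rule l.card_annihilator)
    show "\<exists>y\<in>F1. T1 (x * y) \<noteq> 0" if "x \<in> fst ` W" "x \<noteq> 0" for x
      using that W(2) by (intro field_trace_nondegenerate[OF emb F1]) auto
    show "T1 (x * (emb a * y)) = a * T1 (x * y)" if "x \<in> fst ` W" "y \<in> F1" for a x y
    proof -
      have "x \<in> F1" using that W(2) by auto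
      then show ?thesis using that by (simp add: mult.left_commute[of x] T1_simps)
    qed
  qed (use W(2) in \<open>auto simp: fst.subspace_image[OF W(1)] subspace_F distrib_left distrib_right
        mult.assoc T1_simps dest!: subsetD[OF W(2)]\<close>)
  then show ?thesis by (simp add: perp1_def F1)
qed

lemma card_perp2: "card (snd ` W) * card (perp2 W) = CARD('q) ^ k2"
proof -
  have "card (snd ` W) * card {x \<in> F2. \<forall>b\<in>snd ` W. T2 (b * x) = 0} = card F2"
  proof (rule l.card_annihilator)
    show "\<exists>y\<in>F2. T2 (x * y) \<noteq> 0" if "x \<in> snd ` W" "x \<noteq> 0" for x
      using that W(2) by (intro field_trace_nondegenerate[OF emb F2]) auto
    show "T2 (x * (emb a * y)) = a * T2 (x * y)" if "x \<in> snd ` W" "y \<in> F2" for a x y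
    proof -
      have "x \<in> F2" using that W(2) by auto
      then show ?thesis using that by (simp add: mult.left_commute[of x] T2_simps)
    qed
  qed (use W(2) in \<open>auto simp: snd.subspace_image[OF W(1)] subspace_F distrib_left distrib_right
        mult.assoc T2_simps dest!: subsetD[OF W(2)]\<close>)
  then show ?thesis by (simp add: perp2_def F2)
qed

text \<open>Inclusion and exclusion over the two axes; the 1 is the origin, which lies on
  both.\<close>

lemma card_perp_nonzero:
  "card {r \<in> perp W. fst r \<noteq> 0 \<and> snd r \<noteq> 0} + card (perp1 W) + card (perp2 W)
    = card (perp W) + 1"
proof -
  let ?N = "{r \<in> perp W. fst r \<noteq> 0 \<and> snd r \<noteq> 0}"
  let ?A = "(\<lambda>x. (x, 0::'l)) ` perp1 W" and ?B = "(\<lambda>y. (0::'l, y)) ` perp2 W"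
  have A: "?A = {r \<in> perp W. snd r = 0}"
    using T2_simps(3) by (auto simp: perp_def perp1_def form_def image_iff)
  have B: "?B = {r \<in> perp W. fst r = 0}"
    using T1_simps(3) by (auto simp: perp_def perp2_def form_def image_iff)
  have cA: "card ?A = card (perp1 W)" by (intro card_image inj_onI) simp
  have cB: "card ?B = card (perp2 W)" by (intro card_image inj_onI) simp
  have "0 \<in> perp W"
    using T1_simps(3) T2_simps(3) by (simp add: perp_def form_def zero_prod_def)
  then have "?A \<inter> ?B = {0}"
    unfolding A B by (auto simp: prod_eq_iff zero_prod_def)
  then have "card ?A + card ?B = card (?A \<union> ?B) + 1"
    using card_Un_Int[of ?A ?B] by simp
  moreover have "perp W = ?N \<union> (?A \<union> ?B)"
    unfolding A B by auto
  moreover have "card (?N \<union> (?A \<union> ?B)) = card ?N + card (?A \<union> ?B)"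
    unfolding A B by (rule card_Un_disjoint) auto
  ultimately show ?thesis using cA cB by simp
qed

end

text \<open>These subspaces will attain the minimum weight. They grow by one pair
  \<open>(x, y)\<close> at a time: \<open>x\<close> outside the first projection keeps that
  projection injective, and \<open>y\<close> outside the second one enlarges it as long as it is not
  all of \<open>F2\<close>.\<close>

lemma exists_subspace:
  assumes "j \<le> k1"
  shows "\<exists>W. p.subspace W \<and> W \<subseteq> F1 \<times> F2 \<and> card W = CARD('q) ^ j \<and>
    card (fst ` W) = CARD('q) ^ j \<and> card (snd ` W) = CARD('q) ^ min j k2"
  using assms
proof (induction j)
  case 0
  show ?case by (intro exI[of _ "{0}"]) (use p.subspace_single_0 in \<open>simp add: zero_prod_def\<close>)
next
  case (Suc j)
  let ?q = "CARD('q)"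
  have q2: "2 \<le> ?q" by (rule CARD_field_ge_2)
  obtain W where W: "p.subspace W" "W \<subseteq> F1 \<times> F2" "card W = ?q ^ j"
    "card (fst ` W) = ?q ^ j" "card (snd ` W) = ?q ^ min j k2"
    using Suc by auto
  have "card (fst ` W) < card F1"
    unfolding W F1 using Suc.prems q2 by (intro power_strict_increasing) auto
  then obtain x where x: "x \<in> F1" "x \<notin> fst ` W"
    by (metis card_mono finite linorder_not_less subsetI)
  \<comment> \<open>From \<open>j = k2\<close> on, the second projection already has as many
    elements as \<open>F2\<close>, and \<open>y = 0\<close> leaves it as it is.\<close>
  obtain y where y: "y \<in> F2" "if j < k2 then y \<notin> snd ` W else y = 0"
  proof (cases "j < k2")
    case True
    then have "card (snd ` W) < card F2"
      unfolding W F2 using q2 by (intro power_strict_increasing) auto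
    then obtain y where "y \<in> F2" "y \<notin> snd ` W"
      by (metis card_mono finite linorder_not_less subsetI)
    then show ?thesis using that True by auto
  next
    case False
    then show ?thesis using that[of 0] by simp
  qed
  let ?W = "p.span (insert (x, y) W)"
  have xy: "(x, y) \<notin> W" using x by force
  have sub: "l.subspace (fst ` W)" "l.subspace (snd ` W)"
    using W(1) by (rule fst.subspace_image, rule snd.subspace_image)
  have "p.subspace ?W" by (rule p.subspace_span)
  moreover have "?W \<subseteq> F1 \<times> F2"
    using W(2) x y subspace_F by (intro p.span_minimal) auto
  moreover have "card ?W = ?q ^ Suc j"
    using p.card_span_insert(1)[OF W(1) _ xy] W(3) by simp
  moreover have "card (fst ` ?W) = ?q ^ Suc j"
    using l.card_span_insert(1)[OF sub(1) _ x(2)] W(4) by (simp flip: fst.span_image)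
  moreover have "card (snd ` ?W) = ?q ^ min (Suc j) k2"
  proof (cases "j < k2")
    case True
    then show ?thesis
      using l.card_span_insert(1)[OF sub(2), of y] y W(5) by (simp flip: snd.span_image)
  next
    case False
    then have "y = 0" using y by simp
    then have "snd ` ?W = snd ` W"
      using sub(2) by (simp flip: snd.span_image)
    then show ?thesis using W(5) False by simp
  qed
  ultimately show ?case by blast
qed

end

section \<open>Multiplicative orders\<close>

lemma mult_order_dvd_iff:
  fixes x :: "'l::{field,finite}"
  assumes "x \<noteq> 0"
  shows "x ^ m = 1 \<longleftrightarrow> mult_order x dvd m" and "0 < mult_order x"
proof -
  let ?d = "mult_order x"
  \<comment> \<open>\<open>CARD('l) - 1\<close> witnesses that the set behind \<open>LEAST\<close>
    is not empty.\<close>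
  have "0 < CARD('l) - 1" using CARD_field_ge_2[where 'q = 'l] by simp
  moreover have "x ^ (CARD('l) - 1) = 1"
    using subfield_power_card_minus_1[OF is_subfield_UNIV _ _ assms] by simp
  ultimately have d: "0 < ?d \<and> x ^ ?d = 1"
    unfolding mult_order_def using LeastI[of "\<lambda>m. 0 < m \<and> x ^ m = 1" "CARD('l) - 1"] by simp
  then show "0 < ?d" by simp
  have min: "?d \<le> r" if "0 < r" "x ^ r = 1" for r
    unfolding mult_order_def using that by (intro Least_le) simp
  have "x ^ m = x ^ (?d * (m div ?d) + m mod ?d)" by simp
  also have "\<dots> = x ^ (m mod ?d)"
    unfolding power_add power_mult using d by simp
  finally have e: "x ^ m = x ^ (m mod ?d)" .
  show "x ^ m = 1 \<longleftrightarrow> ?d dvd m"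
  proof
    assume "x ^ m = 1"
    then have "m mod ?d = 0"
      using e min[of "m mod ?d"] d mod_less_divisor[of ?d m] by fastforce
    then show "?d dvd m" by auto
  next
    assume "?d dvd m"
    then show "x ^ m = 1" using e by simp
  qed
qed

lemma power_eq_iff_cong_mult_order:
  fixes x :: "'l::{field,finite}"
  assumes "x \<noteq> 0"
  shows "x ^ i = x ^ j \<longleftrightarrow> [i = j] (mod mult_order x)"
proof -
  have *: "x ^ i = x ^ j \<longleftrightarrow> [i = j] (mod mult_order x)" if "i \<le> j" for i j
  proof -
    have "x ^ i = x ^ j \<longleftrightarrow> x ^ i * x ^ (j - i) = x ^ i * 1"
      using that by (simp flip: power_add) metis
    also have "\<dots> \<longleftrightarrow> mult_order x dvd j - i"
      using assms by (simp add: mult_order_dvd_iff(1)[OF assms])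
    also have "\<dots> \<longleftrightarrow> [i = j] (mod mult_order x)"
      using that by (metis cong_altdef_nat cong_sym_eq)
    finally show ?thesis .
  qed
  show ?thesis
    using *[of i j] *[of j i] by (metis cong_sym_eq nat_le_linear)
qed

lemma primitive_element_nonzero:
  assumes "primitive_element F g"
  shows "g \<noteq> 0"
proof -
  have "g ^ 1 \<in> F - {0}" using assms unfolding primitive_element_def by blast
  then show ?thesis by simp
qed

text \<open>Every nonzero element is one of the first \<open>mult_order g\<close> powers, so the
  order is at least \<open>card F - 1\<close>; it also divides that number.\<close>

lemma mult_order_primitive_element:
  fixes F :: "'l::{field,finite} set"
  assumes F: "is_subfield F" and g: "primitive_element F g"
  shows "mult_order g = card F - 1"
proof -
  let ?d = "mult_order g"
  have g0: "g \<noteq> 0" using g by (rule primitive_element_nonzero)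
  note ord = mult_order_dvd_iff[OF g0]
  have card: "card (F - {0}) = card F - 1"
    using F by (simp add: is_subfield_def card_Diff_singleton)
  have "F - {0} \<subseteq> (\<lambda>i. g ^ i) ` {..<?d}"
  proof
    fix x assume "x \<in> F - {0}"
    then obtain i where "x = g ^ i"
      using g unfolding primitive_element_def by blast
    then have "x = g ^ (i mod ?d)"
      using power_eq_iff_cong_mult_order[OF g0, of i "i mod ?d"] by (simp add: cong_def)
    then show "x \<in> (\<lambda>i. g ^ i) ` {..<?d}" using ord(2) by auto
  qed
  then have "card (F - {0}) \<le> ?d"
    using surj_card_le[of "{..<?d}"] by simp
  moreover have "?d dvd card F - 1"
    using subfield_power_card_minus_1[OF F _ _ g0] g ord(1)
    by (simp add: primitive_element_def)
  moreover have "1 \<in> F - {0}" using F by (simp add: is_subfield_def)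
  then have "0 < card (F - {0})" by (auto simp: card_gt_0_iff)
  ultimately show ?thesis
    using card dvd_imp_le[of ?d "card F - 1"] by linarith
qed

text \<open>Two naturals with the same multiples are equal, and \<open>m dvd i\<close> holds exactly
  if \<open>e * m dvd e * i\<close>.\<close>

lemma mult_order_power:
  fixes x :: "'l::{field,finite}"
  assumes "x \<noteq> 0" "mult_order x = e * m" "0 < e"
  shows "mult_order (x ^ e) = m"
proof -
  have iff: "mult_order (x ^ e) dvd i \<longleftrightarrow> m dvd i" for i
    using mult_order_dvd_iff(1)[of "x ^ e" i] mult_order_dvd_iff(1)[OF assms(1), of "e * i"] assms
    by (simp add: power_mult)
  show ?thesis using iff[of m] iff[of "mult_order (x ^ e)"] by (simp add: dvd_antisym)
qed

lemma geometric_quotient: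
  fixes q k :: nat
  assumes "1 \<le> q"
  shows "(q - 1) * (\<Sum>i<k. q ^ i) = q ^ k - 1"
proof -
  have "int ((q - 1) * (\<Sum>i<k. q ^ i)) = int q ^ k - 1"
    using assms power_diff_1_eq[of "int q" k] by (simp add: of_nat_diff)
  also have "\<dots> = int (q ^ k - 1)" using assms by (simp add: of_nat_diff)
  finally show ?thesis by linarith
qed

text \<open>The sum is (q^k1 - 1) / (q - 1), which will be the order of \<alpha>1. A common divisor
  with \<open>q ^ k2 - 1\<close> divides \<open>q - 1\<close> by a Bezout argument. Modulo a divisor
  of \<open>q - 1\<close> the sum is \<open>k1\<close>, so coprimality of \<open>k1\<close> and
  \<open>q - 1\<close> finishes.\<close>

lemma coprime_repunit:
  fixes q k1 k2 :: nat
  assumes q: "2 \<le> q" and k: "coprime k1 k2" "0 < k1" and kq: "coprime k1 (q - 1)"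
  shows "coprime (\<Sum>i<k1. q ^ i) (q ^ k2 - 1)" and "coprime (\<Sum>i<k1. q ^ i) (q - 1)"
proof -
  let ?R = "\<Sum>i<k1. q ^ i"
  have main: "is_unit d" if d: "d dvd ?R" "d dvd q - 1" for d
  proof -
    have "[q = 1] (mod d)"
      using d(2) q by (simp add: cong_altdef_nat)
    then have "[?R = (\<Sum>i<k1. 1 ^ i)] (mod d)"
      by (intro cong_sum cong_pow)
    then have "d dvd k1"
      using d(1) cong_dvd_iff by auto
    then show ?thesis using d(2) kq coprime_common_divisor by blast
  qed
  then show "coprime ?R (q - 1)" by (rule coprimeI)
  show "coprime ?R (q ^ k2 - 1)"
  proof (rule coprimeI)
    fix d assume d: "d dvd ?R" "d dvd q ^ k2 - 1"
    have "d dvd q ^ k1 - 1"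
      using d(1) q by (subst geometric_quotient[symmetric]) auto
    then have c1: "[q ^ k1 = 1] (mod d)" using q by (simp add: cong_altdef_nat)
    have c2: "[q ^ k2 = 1] (mod d)" using d(2) q by (simp add: cong_altdef_nat)
    \<comment> \<open>Modulo \<open>d\<close> both \<open>q ^ k1\<close> and \<open>q ^ k2\<close>
      are 1, so writing \<open>q ^ (k1 * u)\<close> as \<open>q ^ (k2 * v) * q\<close> forces
      \<open>q\<close> to be 1 as well.\<close>
    obtain u v where uv: "k1 * u = k2 * v + 1"
      using bezout_nat[of k1 k2] k by (auto simp: coprime_iff_gcd_eq_1)
    have "[1 = (q ^ k1) ^ u] (mod d)"
      using cong_pow[OF c1, of u] by (simp add: cong_sym)
    also have "(q ^ k1) ^ u = (q ^ k2) ^ v * q"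
      by (simp add: uv flip: power_mult)
    also have "[\<dots> = 1 ^ v * q] (mod d)"
      by (intro cong_mult cong_pow c2) simp
    finally have "[q = 1] (mod d)" by (simp add: cong_sym)
    then have "d dvd q - 1" using q by (simp add: cong_altdef_nat)
    then show "is_unit d" using main d(1) by blast
  qed
qed

section \<open>The cyclic code\<close>

lemma card_subspace_seq:
  fixes D :: "(nat \<Rightarrow> 'q::{field,finite}) set"
  assumes "seq.subspace D" "finite D"
  shows "card D = CARD('q) ^ seq.dim D"
proof -
  interpret s: finite_field_space "scale_fun :: 'q \<Rightarrow> (nat \<Rightarrow> 'q) \<Rightarrow> nat \<Rightarrow> 'q"
    by (intro finite_field_space.intro seq.vector_space_axioms)
  show ?thesis using assms by (rule s.card_subspace)
qed

text \<open>\<open>n1\<close> is (|F1| - 1) / (q - 1), stated without division. The last assumption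
  rules out that both fields are F_2, where encoding is not injective.\<close>

locale cyclic_pair = trace_pair emb F1 F2 k1 k2
  for emb :: "'q::{field,finite} \<Rightarrow> 'l::{field,finite}" and F1 F2 k1 k2 +
  fixes \<alpha>1 \<alpha>2 :: 'l and n1 n2 :: nat
  assumes \<alpha>: "\<alpha>1 \<in> F1" "\<alpha>2 \<in> F2" "\<alpha>1 \<noteq> 0" "\<alpha>2 \<noteq> 0"
    and ord: "mult_order \<alpha>1 = n1" "mult_order \<alpha>2 = n2"
    and n1: "(CARD('q) - 1) * n1 = card F1 - 1" and n2: "n2 = card F2 - 1"
    and coprime: "coprime n1 n2" "coprime n1 (CARD('q) - 1)"
    and nontrivial: "3 \<le> card F1 \<or> 3 \<le> card F2"
begin

abbreviation n :: nat where "n \<equiv> n1 * n2"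

definition point :: "nat \<Rightarrow> 'l \<times> 'l" where
  "point i = (\<alpha>1 ^ i, \<alpha>2 ^ i)"

definition word :: "'l \<times> 'l \<Rightarrow> nat \<Rightarrow> 'q" where
  "word p = codeword emb k1 k2 n \<alpha>1 \<alpha>2 (fst p) (snd p)"

lemma point_mem [simp]: "point i \<in> F1 \<times> F2"
  using \<alpha> by (simp add: point_def)

lemma word_eq: "word p i = (if i < n then form p (point i) else 0)"
  by (simp add: word_def codeword_def form_def point_def)

text \<open>The order of \<open>\<alpha>1\<close> is prime to \<open>q - 1\<close>, so a power of \<open>\<alpha>1\<close> that is a scalar is 1.\<close>

lemma bij_betw_scaled_points:
  "bij_betw (\<lambda>(a, i). pscale a (point i)) ((UNIV - {0}) \<times> {..<n}) ((F1 - {0}) \<times> (F2 - {0}))"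
proof -
  let ?f = "\<lambda>(a, i). pscale a (point i)"
  let ?X = "(UNIV - {0::'q}) \<times> {..<n}" and ?Y = "(F1 - {0}) \<times> (F2 - {0})"
  have inj: "inj_on ?f ?X"
  proof (rule inj_onI)
    fix s t assume st: "s \<in> ?X" "t \<in> ?X" and e: "?f s = ?f t"
    obtain a i b j where s: "s = (a, i)" and t: "t = (b, j)" by (cases s, cases t)
    have a: "a \<noteq> 0" "b \<noteq> 0" and i: "i < n" "j < n" using st by (auto simp: s t)
    have e1: "emb a * \<alpha>1 ^ i = emb b * \<alpha>1 ^ j" and e2: "emb a * \<alpha>2 ^ i = emb b * \<alpha>2 ^ j"
      using e by (simp_all add: s t point_def)
    let ?c = "a / b"
    have n1_power: "(\<alpha>1 ^ m) ^ n1 = 1" for m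
      using mult_order_dvd_iff(1)[OF \<alpha>(3), of "m * n1"] ord by (simp add: power_mult)
    \<comment> \<open>The \<open>n1\<close>-th power removes \<alpha>1, so the order of
      \<open>?c\<close> will divide both \<open>n1\<close> and q - 1.\<close>
    have "emb (a ^ n1) = (emb a * \<alpha>1 ^ i) ^ n1"
      by (simp add: emb_power[OF emb] power_mult_distrib n1_power)
    also have "\<dots> = emb (b ^ n1)"
      unfolding e1 by (simp add: emb_power[OF emb] power_mult_distrib n1_power)
    finally have "a ^ n1 = b ^ n1" using inj_emb[OF emb] by (simp add: inj_eq)
    then have "?c ^ n1 = 1" using a by (simp add: power_divide)
    moreover have "?c ^ (CARD('q) - 1) = 1"
      using subfield_power_card_minus_1[OF is_subfield_UNIV, of ?c] a by simp
    ultimately have "mult_order ?c dvd 1"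
      using mult_order_dvd_iff(1)[of ?c] a coprime_common_divisor[OF coprime(2)] by simp
    then have "?c ^ 1 = 1" using mult_order_dvd_iff(1)[of ?c 1] a by simp
    then have ab: "a = b" using a by simp
    have "emb a \<noteq> 0" using a emb_eq_0_iff[OF emb] by simp
    then have "\<alpha>1 ^ i = \<alpha>1 ^ j" "\<alpha>2 ^ i = \<alpha>2 ^ j" using e1 e2 ab by simp_all
    then have "[i = j] (mod n1)" "[i = j] (mod n2)"
      using power_eq_iff_cong_mult_order \<alpha> ord by blast+
    then have "[i = j] (mod n)" using coprime(1) by (rule coprime_cong_mult_nat)
    then have "i = j" using i by (simp add: cong_less_modulus_unique_nat)
    then show "s = t" by (simp add: s t ab)
  qed
  have sub: "?f ` ?X \<subseteq> ?Y"
  proof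
    fix r assume "r \<in> ?f ` ?X"
    then obtain a i where "a \<noteq> 0" "r = pscale a (point i)" by auto
    then show "r \<in> ?Y" using \<alpha> by (simp add: point_def emb_eq_0_iff[OF emb])
  qed
  \<comment> \<open>Domain and target have the same size, so the injective map is onto.\<close>
  have "card ?X = (CARD('q) - 1) * (n1 * n2)"
    by (simp add: card_cartesian_product card_Diff_singleton)
  also have "\<dots> = (card F1 - 1) * (card F2 - 1)"
    by (simp only: n1 n2 flip: mult.assoc)
  also have "\<dots> = card ?Y"
    by (simp add: card_cartesian_product card_Diff_singleton)
  finally have "card (?f ` ?X) = card ?Y" using card_image[OF inj] by simp
  then have "?f ` ?X = ?Y" using sub by (intro card_subset_eq) auto
  with inj show ?thesis by (simp add: bij_betw_def)
qed

lemma scaled_point_cases: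
  assumes "r \<in> F1 \<times> F2" "fst r \<noteq> 0" "snd r \<noteq> 0"
  obtains a i where "a \<noteq> 0" "i < n" "r = pscale a (point i)"
proof -
  have "r \<in> (\<lambda>(a, i). pscale a (point i)) ` ((UNIV - {0}) \<times> {..<n})"
    unfolding bij_betw_imp_surj_on[OF bij_betw_scaled_points] using assms by auto
  then show thesis using that by auto
qed

lemma form_pscale_point:
  assumes "p \<in> F1 \<times> F2"
  shows "form p (pscale a (point i)) = a * form p (point i)"
  using form_scale_left[OF point_mem assms, of a i] by (simp only: form_commute[of p])

text \<open>A pair in \<open>W\<close> annihilates all nonzero multiples of a point or none, so the
  bijection restricts to the zero positions and gives q - 1 annihilating pairs for each of
  them.\<close>

lemma card_zero_positions:
  assumes "W \<subseteq> F1 \<times> F2"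
  shows "(CARD('q) - 1) * card {i. i < n \<and> (\<forall>p\<in>W. form p (point i) = 0)}
    = card {r \<in> perp W. fst r \<noteq> 0 \<and> snd r \<noteq> 0}"
proof -
  let ?f = "\<lambda>(a, i). pscale a (point i)"
  let ?Z = "{i. i < n \<and> (\<forall>p\<in>W. form p (point i) = 0)}"
  let ?P = "{r \<in> perp W. fst r \<noteq> 0 \<and> snd r \<noteq> 0}"
  have zero_iff: "(\<forall>p\<in>W. form p (pscale a (point i)) = 0) \<longleftrightarrow> (\<forall>p\<in>W. form p (point i) = 0)"
    if "a \<noteq> 0" for a i
    using that form_pscale_point[OF subsetD[OF assms]] by simp
  have "?f ` ((UNIV - {0}) \<times> ?Z) = ?P"
  proof (intro subset_antisym subsetI)
    fix r assume "r \<in> ?f ` ((UNIV - {0}) \<times> ?Z)"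
    then obtain a i where ai: "a \<noteq> 0" "i \<in> ?Z" and r: "r = pscale a (point i)" by auto
    then have "\<forall>p\<in>W. form p r = 0" using zero_iff by blast
    moreover have "r \<in> (F1 - {0}) \<times> (F2 - {0})"
      using bij_betwE[OF bij_betw_scaled_points, rule_format, of "(a, i)"] ai r by simp
    ultimately show "r \<in> ?P" by (auto simp: perp_def)
  next
    fix r assume r: "r \<in> ?P"
    then have "r \<in> F1 \<times> F2" "fst r \<noteq> 0" "snd r \<noteq> 0" by (auto simp: perp_def)
    then obtain a i where ai: "a \<noteq> 0" "i < n" "r = pscale a (point i)"
      by (rule scaled_point_cases)
    moreover have "\<forall>p\<in>W. form p r = 0" using r by (simp add: perp_def)
    ultimately have "i \<in> ?Z" using zero_iff by simp
    with ai show "r \<in> ?f ` ((UNIV - {0}) \<times> ?Z)"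
      by (intro image_eqI[of _ _ "(a, i)"]) auto
  qed
  moreover have "card (?f ` ((UNIV - {0}) \<times> ?Z)) = card ((UNIV - {0::'q}) \<times> ?Z)"
    by (rule card_image, rule inj_on_subset[OF bij_betw_imp_inj_on[OF bij_betw_scaled_points]]) auto
  ultimately have "card ?P = card ((UNIV - {0::'q}) \<times> ?Z)"
    by simp
  then show ?thesis by (simp add: card_cartesian_product card_Diff_singleton)
qed

section \<open>Encoding as an injective linear map\<close>

lemma word_add:
  "p \<in> F1 \<times> F2 \<Longrightarrow> r \<in> F1 \<times> F2 \<Longrightarrow> word (p + r) = word p + word r"
  by (rule ext) (simp add: word_eq form_add_left)

lemma word_scale: "p \<in> F1 \<times> F2 \<Longrightarrow> word (pscale a p) = scale_fun a (word p)"
  by (rule ext) (simp add: word_eq scale_fun_def form_scale_left)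

lemma word_0: "word 0 = 0"
  using word_scale[of 0 0] by (simp add: zero_prod_def emb_simps' scale_fun_def fun_eq_iff)

text \<open>Every pair with two nonzero entries is a multiple of a point, so a zero codeword makes
  the form vanish at all such pairs.\<close>

lemma word_eq_0_imp:
  assumes p: "p \<in> F1 \<times> F2" and zero: "word p = 0"
  shows "p = 0"
proof (rule form_kernel_trivial[OF nontrivial p])
  fix x y assume "x \<in> F1" "x \<noteq> 0" "y \<in> F2" "y \<noteq> 0"
  then have "(x, y) \<in> F1 \<times> F2" "fst (x, y) \<noteq> 0" "snd (x, y) \<noteq> 0" by simp_all
  then obtain a i where ai: "i < n" "(x, y) = pscale a (point i)"
    by (rule scaled_point_cases)
  have "word p i = 0" using zero by simp
  then have "form p (point i) = 0" using ai by (simp add: word_eq)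
  then show "form p (x, y) = 0"
    unfolding ai(2) form_pscale_point[OF p] by simp
qed

lemma inj_on_word: "inj_on word (F1 \<times> F2)"
proof (rule inj_onI)
  fix p r assume pr: "p \<in> F1 \<times> F2" "r \<in> F1 \<times> F2" and e: "word p = word r"
  have d: "p - r \<in> F1 \<times> F2" using pr subspace_F(3) by (rule_tac p.subspace_diff)
  have "word (p - r) + word r = word p"
    using word_add[OF d pr(2)] by simp
  then have "word (p - r) = 0" using e by simp
  then show "p = r" using word_eq_0_imp[OF d] by simp
qed

lemma subspace_word_image:
  assumes W: "p.subspace W" "W \<subseteq> F1 \<times> F2"
  shows "seq.subspace (word ` W)"
proof (rule seq.subspaceI)
  show "0 \<in> word ` W"
    using p.subspace_0[OF W(1)] word_0 by (intro image_eqI[of _ _ 0]) simp_all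
  show "x + y \<in> word ` W" if xy: "x \<in> word ` W" "y \<in> word ` W" for x y
  proof -
    obtain p r where pr: "p \<in> W" "r \<in> W" "x = word p" "y = word r" using xy by auto
    then have "x + y = word (p + r)" using word_add subsetD[OF W(2)] by simp
    then show ?thesis using p.subspace_add[OF W(1)] pr by blast
  qed
  show "scale_fun c x \<in> word ` W" if x: "x \<in> word ` W" for c x
  proof -
    obtain p where p: "p \<in> W" "x = word p" using x by auto
    then have "scale_fun c x = word (pscale c p)" using word_scale subsetD[OF W(2)] by simp
    then show ?thesis using p.subspace_scale[OF W(1) p(1)] by blast
  qed
qed

lemma subspace_word_vimage:
  assumes D: "seq.subspace D"
  shows "p.subspace {p \<in> F1 \<times> F2. word p \<in> D}"
proof (rule p.subspaceI)
  show "0 \<in> {p \<in> F1 \<times> F2. word p \<in> D}"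
    using seq.subspace_0[OF D] word_0 by (simp add: zero_prod_def)
  show "x + y \<in> {p \<in> F1 \<times> F2. word p \<in> D}"
    if "x \<in> {p \<in> F1 \<times> F2. word p \<in> D}" "y \<in> {p \<in> F1 \<times> F2. word p \<in> D}" for x y
    using that seq.subspace_add[OF D] p.subspace_add[OF subspace_F(3)] word_add[of x y] by simp
  show "pscale c x \<in> {p \<in> F1 \<times> F2. word p \<in> D}"
    if "x \<in> {p \<in> F1 \<times> F2. word p \<in> D}" for c x
    using that seq.subspace_scale[OF D] p.subspace_scale[OF subspace_F(3)] word_scale[of x c] by auto
qed

text \<open>By inclusion and exclusion, the zero positions are counted by the annihilator of \<open>W\<close> and its
  intersections with the two coordinate axes. Only the second axis depends on more than \<open>j\<close>.\<close>

lemma card_Supp_word_image: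
  assumes W: "p.subspace W" "W \<subseteq> F1 \<times> F2" and j: "j \<le> k1"
    and card: "card W = CARD('q) ^ j" "card (fst ` W) = CARD('q) ^ j"
  obtains z where "card (Supp n (word ` W)) + z = n"
    and "(CARD('q) - 1) * z + CARD('q) ^ (k1 - j) + card (perp2 W) = CARD('q) ^ (k1 + k2 - j) + 1"
proof -
  let ?q = "CARD('q)"
  let ?Z = "{i. i < n \<and> (\<forall>p\<in>W. form p (point i) = 0)}"
  have "Supp n (word ` W) = {..<n} - ?Z"
    by (auto simp: Supp_def word_eq)
  moreover have "card ({..<n} - ?Z) + card ?Z = n"
    using card_Diff_subset[of ?Z "{..<n}"] card_mono[of "{..<n}" ?Z] by fastforce
  ultimately have Supp: "card (Supp n (word ` W)) + card ?Z = n" by simp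
  have "?q ^ j * card (perp W) = ?q ^ j * ?q ^ (k1 + k2 - j)"
    using card_perp[OF W] card j by (simp flip: power_add)
  then have perp: "card (perp W) = ?q ^ (k1 + k2 - j)" by simp
  have "?q ^ j * card (perp1 W) = ?q ^ j * ?q ^ (k1 - j)"
    using card_perp1[OF W] card j by (simp flip: power_add)
  then have perp1: "card (perp1 W) = ?q ^ (k1 - j)" by simp
  show thesis
    using that[OF Supp] card_zero_positions[OF W(2)] card_perp_nonzero[OF W] perp perp1 by simp
qed

text \<open>Equal sizes make the first projection injective on \<open>W\<close>, while the words of
  C' come from pairs with first entry 0; hence only the zero word is common.\<close>

lemma word_image_properties:
  assumes W: "p.subspace W" "W \<subseteq> F1 \<times> F2"
    and card: "card W = CARD('q) ^ j" "card (fst ` W) = CARD('q) ^ j"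
  shows "seq.dim (word ` W) = j" and "word ` W \<inter> word ` ({0} \<times> F2) = {0}"
proof -
  have inj: "inj_on word W" using inj_on_word W(2) by (rule inj_on_subset)
  have "CARD('q) ^ seq.dim (word ` W) = CARD('q) ^ j"
    using card_subspace_seq[OF subspace_word_image[OF W]] card_image[OF inj] card(1) by simp
  then show "seq.dim (word ` W) = j"
    using CARD_field_ge_2[where 'q = 'q] by (simp add: power_inject_exp)
  have inj_fst: "inj_on fst W" using card by (intro eq_card_imp_inj_on) simp_all
  have "v = 0" if v: "v \<in> word ` W" "v \<in> word ` ({0} \<times> F2)" for v
  proof -
    obtain p where p: "p \<in> W" "v = word p" using v(1) by (rule imageE)
    obtain r where r: "r \<in> {0} \<times> F2" "v = word r" using v(2) by (rule imageE)
    have "r \<in> F1 \<times> F2" using r(1) by auto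
    then have "p = r" using inj_onD[OF inj_on_word] p r(2) subsetD[OF W(2)] by simp
    then have "fst p = fst 0" using r(1) by auto
    then have "p = 0" using inj_onD[OF inj_fst] p(1) p.subspace_0[OF W(1)] by simp
    then show ?thesis using p(2) word_0 by simp
  qed
  moreover have "word 0 \<in> word ` W"
    using p.subspace_0[OF W(1)] by (rule imageI)
  moreover have "(0 :: 'l \<times> 'l) \<in> {0} \<times> F2" by (simp add: zero_prod_def)
  then have "word 0 \<in> word ` ({0} \<times> F2)" by (rule imageI)
  ultimately show "word ` W \<inter> word ` ({0} \<times> F2) = {0}"
    unfolding word_0 by blast
qed

text \<open>Conversely, \<open>W\<close> is the preimage of \<open>D\<close>. A pair of
  \<open>W\<close> with first entry 0 encodes to a word of C', hence to 0, so \<open>fst\<close> is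
  injective on \<open>W\<close>.\<close>

lemma subcode_cases:
  assumes D: "seq.subspace D" "D \<subseteq> word ` (F1 \<times> F2)" "D \<inter> word ` ({0} \<times> F2) = {0}"
  obtains W where "p.subspace W" "W \<subseteq> F1 \<times> F2" "D = word ` W"
    "card W = CARD('q) ^ seq.dim D" "card (fst ` W) = CARD('q) ^ seq.dim D"
proof -
  define W where "W = {p \<in> F1 \<times> F2. word p \<in> D}"
  have W: "p.subspace W" "W \<subseteq> F1 \<times> F2"
    unfolding W_def using subspace_word_vimage[OF D(1)] by auto
  have DW: "D = word ` W" using D(2) unfolding W_def by blast
  have "inj_on word W" using inj_on_word W(2) by (rule inj_on_subset)
  then have "card W = card D" unfolding DW by (simp add: card_image)
  then have card: "card W = CARD('q) ^ seq.dim D"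
    using card_subspace_seq[OF D(1)] DW by simp
  have "inj_on fst W"
    unfolding fst.inj_on_iff_eq_0[OF W(1)]
  proof (intro ballI impI)
    fix p assume p: "p \<in> W" "fst p = 0"
    have pF: "p \<in> F1 \<times> F2" using W(2) p(1) by (rule subsetD)
    then have "p \<in> {0} \<times> F2" using p(2) by auto
    moreover have "word p \<in> D" unfolding DW using p(1) by (rule imageI)
    ultimately have "word p = 0" using D(3) by blast
    with pF show "p = 0" by (rule word_eq_0_imp)
  qed
  then have "card (fst ` W) = CARD('q) ^ seq.dim D" using card by (simp add: card_image)
  with W DW card show thesis by (rule that)
qed

text \<open>The second projection has at most q^j elements, so its annihilator in \<open>F2\<close>
  cannot be smaller than this.\<close>

lemma card_perp2_ge:
  assumes W: "p.subspace W" "W \<subseteq> F1 \<times> F2" and card: "card W = CARD('q) ^ j"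
  shows "CARD('q) ^ (k2 - j) \<le> card (perp2 W)"
proof (cases "j \<le> k2")
  case True
  have "CARD('q) ^ j * CARD('q) ^ (k2 - j) = card (snd ` W) * card (perp2 W)"
    using card_perp2[OF W] True by (simp flip: power_add)
  also have "\<dots> \<le> CARD('q) ^ j * card (perp2 W)"
    using card_image_le[of W snd] card by (intro mult_right_mono) simp_all
  finally show ?thesis by simp
next
  case False
  \<comment> \<open>Here \<open>k2 - j\<close> truncates to 0, and only nonemptiness of
    \<open>perp2 W\<close> is claimed.\<close>
  have "0 < card (snd ` W) * card (perp2 W)" unfolding card_perp2[OF W] by simp
  then show ?thesis using False by simp
qed

text \<open>\<open>N\<close> is N_j, pinned down by an equation that needs no division. The subspace
  from \<open>exists_subspace\<close> reaches the bound of \<open>card_perp2_ge\<close>, hence the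
  most zero positions; by \<open>subcode_cases\<close> every competing subcode comes from a subspace
  to which that bound applies.\<close>

lemma rel_gen_hamming_weight_eq:
  assumes j: "j \<le> k1"
  obtains N where "rel_gen_hamming_weight n (word ` (F1 \<times> F2)) (word ` ({0} \<times> F2)) j + N = n"
    and "(CARD('q) - 1) * N + CARD('q) ^ (k1 - j) + CARD('q) ^ (k2 - j) = CARD('q) ^ (k1 + k2 - j) + 1"
proof -
  let ?q = "CARD('q)"
  let ?S = "{card (Supp n D) | D. seq.subspace D \<and> D \<subseteq> word ` (F1 \<times> F2) \<and>
    seq.dim D = j \<and> D \<inter> word ` ({0} \<times> F2) = {0}}"
  have q2: "2 \<le> ?q" by (rule CARD_field_ge_2)
  obtain W where W: "p.subspace W" "W \<subseteq> F1 \<times> F2" "card W = ?q ^ j"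
    "card (fst ` W) = ?q ^ j" "card (snd ` W) = ?q ^ min j k2"
    using exists_subspace[OF j] by (elim exE conjE)
  obtain N where N: "card (Supp n (word ` W)) + N = n"
    "(?q - 1) * N + ?q ^ (k1 - j) + card (perp2 W) = ?q ^ (k1 + k2 - j) + 1"
    using W(1,2) j W(3,4) by (rule card_Supp_word_image)
  \<comment> \<open>For \<open>j > k2\<close> the second projection is all of \<open>F2\<close>;
    both sides are then \<open>?q ^ k2\<close>, as \<open>k2 - j\<close> is 0.\<close>
  have "?q ^ min j k2 * card (perp2 W) = ?q ^ min j k2 * ?q ^ (k2 - j)"
    using card_perp2[OF W(1,2)] W(5) by (simp add: min_def flip: power_add)
  then have perp2: "card (perp2 W) = ?q ^ (k2 - j)" by simp
  \<comment> \<open>Supports lie below \<open>n\<close>, so \<open>?S\<close> is finite, as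
    \<open>Min\<close> requires.\<close>
  have "card (Supp n D) \<le> n" for D :: "(nat \<Rightarrow> 'q) set"
    using card_mono[of "{..<n}" "Supp n D"] by (auto simp: Supp_def)
  then have "?S \<subseteq> {..n}" by auto
  then have fin: "finite ?S" by (rule finite_subset) simp
  have mem: "card (Supp n (word ` W)) \<in> ?S"
    using subspace_word_image[OF W(1,2)] word_image_properties[OF W(1-4)] image_mono[OF W(2)]
    by (intro CollectI exI[of _ "word ` W"] conjI refl)
  have le: "card (Supp n (word ` W)) \<le> s" if s: "s \<in> ?S" for s
  proof -
    obtain D where s_eq: "s = card (Supp n D)" and dim: "seq.dim D = j"
      and D: "seq.subspace D" "D \<subseteq> word ` (F1 \<times> F2)" "D \<inter> word ` ({0} \<times> F2) = {0}"
      using s by (elim CollectE exE conjE)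
    obtain V where V: "p.subspace V" "V \<subseteq> F1 \<times> F2" "D = word ` V"
      "card V = ?q ^ j" "card (fst ` V) = ?q ^ j"
      using subcode_cases[OF D] unfolding dim .
    obtain z where z: "card (Supp n (word ` V)) + z = n"
      "(?q - 1) * z + ?q ^ (k1 - j) + card (perp2 V) = ?q ^ (k1 + k2 - j) + 1"
      using V(1,2) j V(4,5) by (rule card_Supp_word_image)
    \<comment> \<open>The two equations differ only in the zero count and the size of
      \<open>perp2\<close>, so a larger \<open>perp2\<close> means fewer zero positions.\<close>
    have "(?q - 1) * z \<le> (?q - 1) * N"
      using card_perp2_ge[OF V(1,2,4)] z(2) N(2) perp2 by linarith
    then have "z \<le> N" using q2 by simp
    then show ?thesis unfolding s_eq V(3) using z(1) N(1) by linarith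
  qed
  have "rel_gen_hamming_weight n (word ` (F1 \<times> F2)) (word ` ({0} \<times> F2)) j = card (Supp n (word ` W))"
    unfolding rel_gen_hamming_weight_def using fin le mem by (rule Min_eqI)
  then show thesis using that[of N] N perp2 by simp
qed

end

section \<open>Closed form of N_j and the theorem\<close>

lemma relative_weight_formula:
  fixes q k1 k2 j N :: nat
  assumes q: "2 \<le> q" and j: "j \<le> k1"
    and N: "(q - 1) * N + q ^ (k1 - j) + q ^ (k2 - j) = q ^ (k1 + k2 - j) + 1"
  shows "int N =
    (if k1 \<le> k2 then
       (\<Sum>\<kappa>\<in>{k2 - j..<k1 + k2 - j}. int q ^ \<kappa>) - (\<Sum>\<iota>\<in>{0..<k1 - j}. int q ^ \<iota>)
     else if j \<le> k2 then
       (\<Sum>\<kappa>\<in>{k1 - j..<k1 + k2 - j}. int q ^ \<kappa>) - (\<Sum>\<iota>\<in>{0..<k2 - j}. int q ^ \<iota>)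
     else
       int q ^ (k1 - j) * (\<Sum>\<iota>\<in>{0..<k2}. int q ^ \<iota>))" (is "_ = ?R")
proof -
  \<comment> \<open>Multiplying by q - 1 turns each geometric sum into a difference of two powers,
    so all three cases can be compared with the equation for \<open>N\<close>.\<close>
  have geo: "(int q - 1) * (\<Sum>i\<in>{0..<b}. int q ^ i) = int q ^ b - 1" for b
    using power_diff_1_eq[of "int q" b] by (simp add: lessThan_atLeast0)
  have geo2: "(int q - 1) * (\<Sum>i\<in>{a..<b}. int q ^ i) = int q ^ b - int q ^ a" if "a \<le> b" for a b
  proof -
    have "(\<Sum>i\<in>{a..<b}. int q ^ i) = (\<Sum>i\<in>{0..<b}. int q ^ i) - (\<Sum>i\<in>{0..<a}. int q ^ i)"
      using sum.atLeastLessThan_concat[of 0 a b "\<lambda>i. int q ^ i"] that by linarith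
    then show ?thesis by (simp add: right_diff_distrib geo)
  qed
  have "int ((q - 1) * N + q ^ (k1 - j) + q ^ (k2 - j)) = int (q ^ (k1 + k2 - j) + 1)"
    using N by simp
  then have "(int q - 1) * int N = int q ^ (k1 + k2 - j) + 1 - int q ^ (k1 - j) - int q ^ (k2 - j)"
    using q by (simp add: of_nat_diff)
  also have "\<dots> = (int q - 1) * ?R"
  proof -
    \<comment> \<open>If \<open>j > k2\<close>, then \<open>q ^ (k2 - j)\<close> is 1 and cancels
      the constant 1, which leaves the product formula.\<close>
    have "k1 + k2 - j = (k1 - j) + k2" using j by simp
    then have "int q ^ (k1 - j) * int q ^ k2 = int q ^ (k1 + k2 - j)" by (simp add: power_add)
    moreover have "(int q - 1) * (int q ^ (k1 - j) * (\<Sum>\<iota>\<in>{0..<k2}. int q ^ \<iota>))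
        = int q ^ (k1 - j) * (int q ^ k2 - 1)"
      by (simp only: mult.left_commute[of "int q - 1"] geo)
    ultimately show ?thesis
      using j by (auto simp: right_diff_distrib geo geo2)
  qed
  finally show ?thesis using q by simp
qed

theorem corollary2p3:
  fixes emb :: "'q::{field,finite} \<Rightarrow> 'l::{field,finite}"
    and F1 F2 :: "'l set"
    and \<gamma>1 \<gamma>2 \<alpha>1 \<alpha>2 :: 'l
    and q k1 k2 Q1 Q2 e1 e2 n1 n2 n :: nat
    and C C' :: "(nat \<Rightarrow> 'q) set"
  assumes emb: "field_embedding emb"
    and q: "q = CARD('q)"
    and k1: "k1 \<ge> 1" and k2: "k2 \<ge> 1"
    and coprime_k1_k2: "gcd k1 k2 = 1"
    and k1_odd: "\<not> 2 dvd k1"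
    and coprime_k1_q1: "gcd k1 (q - 1) = 1"
    and Q1: "Q1 = q ^ k1" and Q2: "Q2 = q ^ k2"
    and F1: "is_subfield F1" "range emb \<subseteq> F1" "card F1 = Q1"
    and F2: "is_subfield F2" "range emb \<subseteq> F2" "card F2 = Q2"
    and \<gamma>1: "primitive_element F1 \<gamma>1"
    and \<gamma>2: "primitive_element F2 \<gamma>2"
    and e1: "e1 = q - 1" and e2: "e2 = 1"
    and \<alpha>1: "\<alpha>1 = \<gamma>1 ^ e1" and \<alpha>2: "\<alpha>2 = \<gamma>2 ^ e2"
    and not_conj: "\<not> conjugate_over q \<alpha>1 \<alpha>2"
    and n1: "n1 = mult_order \<alpha>1" and n2: "n2 = mult_order \<alpha>2"
    and n: "n = n1 * n2 div gcd n1 n2"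
    and C: "C = {codeword emb k1 k2 n \<alpha>1 \<alpha>2 \<beta>1 \<beta>2 | \<beta>1 \<beta>2. \<beta>1 \<in> F1 \<and> \<beta>2 \<in> F2}"
    and C': "C' = {codeword emb k1 k2 n \<alpha>1 \<alpha>2 0 \<beta>2 | \<beta>2. \<beta>2 \<in> F2}"
  shows "C \<subseteq> coord_space n \<and> C' \<subseteq> coord_space n
    \<and> n = n1 * n2
    \<and> real n = (real Q1 - 1) * (real Q2 - 1) / (real q - 1)
    \<and> (\<forall>j. 1 \<le> j \<and> j \<le> k1 \<longrightarrow>
        int (rel_gen_hamming_weight n C C' j) = int n -
          (if k1 \<le> k2 then
             (\<Sum>\<kappa>\<in>{k2 - j..<k1 + k2 - j}. int q ^ \<kappa>) - (\<Sum>\<iota>\<in>{0..<k1 - j}. int q ^ \<iota>)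
           else if j \<le> k2 then
             (\<Sum>\<kappa>\<in>{k1 - j..<k1 + k2 - j}. int q ^ \<kappa>) - (\<Sum>\<iota>\<in>{0..<k2 - j}. int q ^ \<iota>)
           else
             int q ^ (k1 - j) * (\<Sum>\<iota>\<in>{0..<k2}. int q ^ \<iota>)))"
proof -
  have q2: "2 \<le> q" unfolding q by (rule CARD_field_ge_2)
  let ?R = "\<Sum>i<k1. q ^ i"
  have R: "(q - 1) * ?R = Q1 - 1"
    unfolding Q1 using q2 by (intro geometric_quotient) simp
  have \<gamma>0: "\<gamma>1 \<noteq> 0" "\<gamma>2 \<noteq> 0"
    using primitive_element_nonzero \<gamma>1 \<gamma>2 by blast+
  have "\<gamma>1 ^ e1 \<in> F1 - {0}" "\<gamma>2 ^ e2 \<in> F2 - {0}"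
    using \<gamma>1 \<gamma>2 unfolding primitive_element_def by blast+
  then have \<alpha>F: "\<alpha>1 \<in> F1" "\<alpha>2 \<in> F2" and \<alpha>0: "\<alpha>1 \<noteq> 0" "\<alpha>2 \<noteq> 0"
    by (simp_all add: \<alpha>1 \<alpha>2)
  \<comment> \<open>The order of \<gamma>1 is \<open>Q1 - 1\<close>, which is
    \<open>(q - 1) * ?R\<close>, so its power with exponent \<open>q - 1\<close> has order
    \<open>?R\<close>.\<close>
  have n1_eq: "n1 = ?R"
    unfolding n1 \<alpha>1 e1 using mult_order_primitive_element[OF F1(1) \<gamma>1] R F1(3) q2 \<gamma>0
    by (intro mult_order_power) simp_all
  have n2_eq: "n2 = Q2 - 1"
    unfolding n2 \<alpha>2 e2 using mult_order_primitive_element[OF F2(1) \<gamma>2] F2(3) by simp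
  have cop: "coprime n1 n2" "coprime n1 (q - 1)"
    using coprime_repunit[of q k1 k2] q2 k1 coprime_k1_k2 coprime_k1_q1
    by (simp_all add: n1_eq n2_eq Q2 coprime_iff_gcd_eq_1)
  have n_eq: "n = n1 * n2" using cop(1) by (simp add: n)
  \<comment> \<open>If both fields had two elements, \<alpha>1 and \<alpha>2 would both be 1, and 1
    is conjugate to itself.\<close>
  have nontrivial: "3 \<le> card F1 \<or> 3 \<le> card F2"
  proof (rule ccontr)
    assume "\<not> ?thesis"
    moreover have "q \<le> q ^ k1" "q \<le> q ^ k2"
      using q2 k1 k2 self_le_power[of q] by simp_all
    ultimately have "card F1 = 2" "card F2 = 2"
      using q2 F1(3) F2(3) Q1 Q2 by auto
    then have "\<alpha>1 = 1" "\<alpha>2 = 1"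
      using subfield_power_card_minus_1[OF F1(1) _ \<alpha>F(1) \<alpha>0(1)]
        subfield_power_card_minus_1[OF F2(1) _ \<alpha>F(2) \<alpha>0(2)] by simp_all
    then show False using not_conj by (simp add: conjugate_over_def)
  qed
  interpret c: cyclic_pair emb F1 F2 k1 k2 \<alpha>1 \<alpha>2 n1 n2
  proof
    show "card F1 = CARD('q) ^ k1" "card F2 = CARD('q) ^ k2"
      using F1(3) F2(3) by (simp_all only: Q1 Q2 q)
    show "(CARD('q) - 1) * n1 = card F1 - 1"
      using R by (simp only: n1_eq F1(3) q)
    show "n2 = card F2 - 1" by (simp only: n2_eq F2(3))
    show "coprime n1 (CARD('q) - 1)" using cop(2) by (simp only: q)
  qed (fact emb F1 F2 \<alpha>F \<alpha>0 n1[symmetric] n2[symmetric] cop nontrivial)+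
  have word: "codeword emb k1 k2 n \<alpha>1 \<alpha>2 \<beta>1 \<beta>2 = c.word (\<beta>1, \<beta>2)" for \<beta>1 \<beta>2
    by (simp add: c.word_def n_eq)
  have C_eq: "C = c.word ` (F1 \<times> F2)" and C'_eq: "C' = c.word ` ({0} \<times> F2)"
    unfolding C C' word by blast+
  have "C \<subseteq> coord_space n" "C' \<subseteq> coord_space n"
    unfolding C C' coord_space_def codeword_def by auto
  moreover have "real n = (real Q1 - 1) * (real Q2 - 1) / (real q - 1)"
  proof -
    have Q: "1 \<le> Q1" "1 \<le> Q2" using q2 by (simp_all add: Q1 Q2)
    \<comment> \<open>The length formula is obtained as an equation of products of naturals before
      dividing.\<close>
    have "real ((q - 1) * n) = real ((Q1 - 1) * (Q2 - 1))"
      by (simp only: n_eq n1_eq n2_eq flip: R mult.assoc)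
    then show ?thesis using q2 Q by (simp add: of_nat_diff field_simps)
  qed
  moreover have "int (rel_gen_hamming_weight n C C' j) = int n -
      (if k1 \<le> k2 then
         (\<Sum>\<kappa>\<in>{k2 - j..<k1 + k2 - j}. int q ^ \<kappa>) - (\<Sum>\<iota>\<in>{0..<k1 - j}. int q ^ \<iota>)
       else if j \<le> k2 then
         (\<Sum>\<kappa>\<in>{k1 - j..<k1 + k2 - j}. int q ^ \<kappa>) - (\<Sum>\<iota>\<in>{0..<k2 - j}. int q ^ \<iota>)
       else
         int q ^ (k1 - j) * (\<Sum>\<iota>\<in>{0..<k2}. int q ^ \<iota>))" if j: "j \<le> k1" for j
  proof -
    obtain N where N: "rel_gen_hamming_weight n C C' j + N = n"
      "(q - 1) * N + q ^ (k1 - j) + q ^ (k2 - j) = q ^ (k1 + k2 - j) + 1"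
      by (rule c.rel_gen_hamming_weight_eq[OF j, folded C_eq C'_eq n_eq q])
    have "int (rel_gen_hamming_weight n C C' j) = int n - int N" using N(1) by linarith
    then show ?thesis unfolding relative_weight_formula[OF q2 j N(2)] .
  qed
  ultimately show ?thesis using n_eq by blast
qed

end
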